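(* The model checking problem for PHL formulas of the form $\exists\sigma_1\ldots\exists\sigma_n.\big((\forall\pi_1:\sigma_1\ldots\forall\pi_n:\sigma_n.\psi)\wedge P\bowtie c\big)$, where $\psi$ contains no path quantifiers, $P$ is a probabilistic expression, $\bowtie\in\{<,\le,>,\ge\}$ and $c\in\mathbb{Q}$, is undecidable: there is no algorithm that, given a finite MDP $M$ and such a closed formula $\Phi$, decides whether $M\models\Phi$.
   Context: A Markov decision process (MDP) is $M=(S,\mathit{Act},\mathbf{P},\iota,\mathsf{AP},L)$ with finite $S,\mathit{Act}$, $\mathbf{P}:S\times\mathit{Act}\times S\to[0,1]$ with $\sum_{s'}\mathbf{P}(s,a,s')\in\{0,1\}$ (action $a$ enabled in $s$ iff the sum is $1$), initial distribution $\iota$, labelling $L:S\to2^{\mathsf{AP}}$. A scheduler is a function $\mathfrak S:(S\cdot\mathit{Act})^*S\to\mathcal D(\mathit{Act})$ supported on enabled actions; it induces a Markov chain $M_{\mathfrak S}$ on histories with $\mathbf{P}_{\mathfrak S}(h,h\cdot s')=\sum_a\mathfrak S(h)(a)\mathbf{P}(s_n,a,s')$ ($s_n$ the last state of $h$), initial distribution $\iota$ and labels $L(s_n)$, with the usual probability measure on infinite paths. The $n$-self-composition $M^n$ has states $S^n$, actions $\mathit{Act}^n$, product probabilities $\prod_i\mathbf{P}(s_i,a_i,s'_i)$, initial distribution $\iota(s)$ on $(s,\dots,s)$ and $0$ elsewhere; schedulers $\mathfrak S_1,\dots,\mathfrak S_n$ compose componentwise into a scheduler $\mathfrak S_1\|\cdots\|\mathfrak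 S_n$ for $M^n$. Probabilistic expressions: $P::=\mathbb{P}(\varphi)\mid P+P\mid c\cdot P$ ($c\in\mathbb{Q}$), $\varphi$ an LTL formula over propositions $a_{\sigma_j}$, $a\in\mathsf{AP}$; $\psi$ is built from propositions $a_{\pi_j}$ with Boolean operators, $\bigcirc$ and $\mathcal U$ (and derived operators). Semantics: $M\models\Phi$ iff there exist schedulers $\mathfrak S_1,\dots,\mathfrak S_n$ for $M$ such that (i) every tuple $(\rho_1,\dots,\rho_n)$ with $\rho_j$ an infinite path of $M_{\mathfrak S_j}$ satisfies $\psi$, where $a_{\pi_j}$ holds iff $a$ labels the current state of $\rho_j$ and temporal operators advance all paths synchronously; and (ii) the value of $P$ in the Markov chain induced on $M^n$ by $\mathfrak S_1\|\cdots\|\mathfrak S_n$ satisfies $\bowtie c$, where $\mathbb{P}(\varphi)$ is the probability of the set of infinite paths satisfying $\varphi$, $a_{\sigma_j}$ holds in $(s_1,\dots,s_n)$ iff $a\in L(s_j)$, and sums and scalar multiples are evaluated arithmetically. *)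

theory Defs
  imports "HOL-Probability.Probability" "HOL-Library.Nat_Bijection"
begin

section \<open>Partial recursive functions\<close>

text \<open>
  Algorithms are Kleene's partial recursive functions on natural numbers, given by programs.
  \<^term>\<open>rec_eval f xs y\<close> states that the program \<open>f\<close> halts on the argument list \<open>xs\<close>
  with result \<open>y\<close>. In \<open>RMin f\<close> the first argument of \<open>f\<close> is minimised, and \<open>f\<close> has to be
  defined on all smaller values.
\<close>

datatype recf =
    RZero
  | RSucc
  | RProj nat
  | RComp recf "recf list"
  | RPrim recf recf
  | RMin recf

inductive rec_eval :: "recf \<Rightarrow> nat list \<Rightarrow> nat \<Rightarrow> bool" where
  zero: "rec_eval RZero xs 0"
| succ: "rec_eval RSucc [x] (Suc x)"
| proj: "i < length xs \<Longrightarrow> rec_eval (RProj i) xs (xs ! i)"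
| comp: "list_all2 (\<lambda>g y. rec_eval g xs y) gs ys \<Longrightarrow> rec_eval f ys z \<Longrightarrow>
    rec_eval (RComp f gs) xs z"
| prim_0: "rec_eval g xs y \<Longrightarrow> rec_eval (RPrim g h) (0 # xs) y"
| prim_Suc: "rec_eval (RPrim g h) (n # xs) y \<Longrightarrow> rec_eval h (n # y # xs) z \<Longrightarrow>
    rec_eval (RPrim g h) (Suc n # xs) z"
| min: "rec_eval f (n # xs) 0 \<Longrightarrow> \<forall>m<n. \<exists>y. y \<noteq> 0 \<and> rec_eval f (m # xs) y \<Longrightarrow>
    rec_eval (RMin f) xs n"

inductive_cases rec_eval_elims:
  "rec_eval RZero xs z"
  "rec_eval RSucc xs z"
  "rec_eval (RProj i) xs z"
  "rec_eval (RComp f gs) xs z"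
  "rec_eval (RPrim g h) (0 # xs) z"
  "rec_eval (RPrim g h) (Suc n # xs) z"
  "rec_eval (RMin f) xs z"

lemma rec_eval_deterministic: "rec_eval f xs y \<Longrightarrow> rec_eval f xs z \<Longrightarrow> y = z"
proof (induction arbitrary: z rule: rec_eval.induct)
  case (comp xs gs ys f w)
  from comp.prems obtain ys' where ys': "list_all2 (\<lambda>g y. rec_eval g xs y) gs ys'"
    and f: "rec_eval f ys' z"
    by (rule rec_eval_elims(4))
  have "ys = ys'"
  proof (rule nth_equalityI)
    show "length ys = length ys'"
      using list_all2_lengthD[OF comp.IH(1)] list_all2_lengthD[OF ys'] by simp
    show "ys ! i = ys' ! i" if "i < length ys" for i
      using comp.IH(1) ys' that by (simp add: list_all2_conv_all_nth)
  qed
  with f comp.IH(2) show ?case by blast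
next
  case (prim_Suc g h n xs y w)
  from prim_Suc.prems obtain y' where "rec_eval (RPrim g h) (n # xs) y'"
    and "rec_eval h (n # y' # xs) z"
    by (rule rec_eval_elims(6))
  with prim_Suc.IH show ?case by blast
next
  case (min f n xs)
  from min.prems have z: "rec_eval f (z # xs) 0"
    and lt: "\<forall>m<z. \<exists>y. y \<noteq> 0 \<and> rec_eval f (m # xs) y"
    by (auto elim: rec_eval_elims(7))
  have "\<not> n < z" using lt min.IH(1) by metis
  moreover have "\<not> z < n" using min.IH(2) z by metis
  ultimately show ?case by simp
next
  case (prim_0 g xs y h)
  then show ?case by (metis rec_eval_elims(5))
next
  case (zero xs)
  then show ?case by (rule rec_eval_elims(1)) simp
next
  case (succ x)
  then show ?case by (rule rec_eval_elims(2)) simp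
next
  case (proj i xs)
  from proj.prems show ?case by (rule rec_eval_elims(3)) simp
qed

section \<open>Markov chains and their path measure\<close>

record ('h, 'p) mc =
  mc_init :: "'h pmf"
  mc_step :: "'h \<Rightarrow> 'h pmf"
  mc_label :: "'h \<Rightarrow> 'p set"

definition mc_paths :: "('h, 'p) mc \<Rightarrow> (nat \<Rightarrow> 'h) set" where
  "mc_paths C = {\<rho>. \<rho> 0 \<in> set_pmf (mc_init C) \<and> (\<forall>i. \<rho> (Suc i) \<in> set_pmf (mc_step C (\<rho> i)))}"

definition mc_kernel :: "('h, 'p) mc \<Rightarrow> nat \<Rightarrow> (nat \<Rightarrow> 'h) \<Rightarrow> 'h measure" where
  "mc_kernel C n \<rho> = measure_pmf (case n of 0 \<Rightarrow> mc_init C | Suc i \<Rightarrow> mc_step C (\<rho> i))"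

text \<open>
  The measure on infinite sequences with the given one-step kernels, obtained from the
  theorem of Ionescu-Tulcea. It is characterised by its values on cylinder sets, see the lemma
  \<open>measure_mc_cylinder\<close> below.
\<close>

definition mc_measure :: "('h, 'p) mc \<Rightarrow> (nat \<Rightarrow> 'h) measure" where
  "mc_measure C = projective_family.lim UNIV
     (Ionescu_Tulcea.CI (mc_kernel C) (\<lambda>_. count_space UNIV)) (\<lambda>_. count_space UNIV)"

lemma Ionescu_Tulcea_mc: "Ionescu_Tulcea (mc_kernel C) (\<lambda>_. count_space UNIV)"
proof (rule Ionescu_Tulcea.intro)
  fix i
  show "mc_kernel C i \<in> (PiM {0..<i} (\<lambda>_. count_space UNIV)) \<rightarrow>\<^sub>M subprob_algebra (count_space UNIV)"
  proof (cases i)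
    case 0
    then show ?thesis
      by (simp add: mc_kernel_def[abs_def] measure_pmf_in_subprob_algebra)
  next
    case (Suc j)
    have "(\<lambda>\<rho>. \<rho> j) \<in> (PiM {0..<i} (\<lambda>_. count_space UNIV)) \<rightarrow>\<^sub>M count_space UNIV"
      using Suc by (intro measurable_component_singleton) simp
    moreover have "(\<lambda>h. measure_pmf (mc_step C h)) \<in> count_space UNIV \<rightarrow>\<^sub>M subprob_algebra (count_space UNIV)"
      by (simp add: measure_pmf_in_subprob_algebra)
    ultimately show ?thesis
      unfolding mc_kernel_def[abs_def] Suc nat.case by (rule measurable_compose)
  qed
next
  show "prob_space (mc_kernel C i \<rho>)" for i \<rho>
    unfolding mc_kernel_def by (rule measure_pmf.prob_space_axioms)
qed

lemma measure_mc_cylinder: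
  "measure (mc_measure C) {\<rho>. \<forall>i\<le>n. \<rho> i = h i} =
     pmf (mc_init C) (h 0) * (\<Prod>i<n. pmf (mc_step C (h i)) (h (Suc i)))"
proof -
  interpret IT: Ionescu_Tulcea "mc_kernel C" "\<lambda>_. count_space UNIV"
    by (rule Ionescu_Tulcea_mc)
  let ?N = "\<lambda>m. PiM {0..<m} (\<lambda>_::nat. count_space (UNIV :: 'a set))"
  define A where "A m = {restrict h {0..<m}}" for m
  have A_PiE: "A m = PiE {0..<m} (\<lambda>i. {h i})" for m
    by (auto simp: A_def PiE_iff extensional_def restrict_def)
  have A_sets[measurable]: "A m \<in> sets (?N m)" for m
    unfolding A_PiE by (intro sets_PiM_I_finite) auto
  have kernel_restrict: "mc_kernel C m (restrict h {0..<m}) = mc_kernel C m h" for m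
    by (cases m) (simp_all add: mc_kernel_def)
  have C_A: "emeasure (IT.C 0 m (\<lambda>_. undefined)) (A m) =
      (\<Prod>i<m. emeasure (mc_kernel C i h) {h i})" for m
  proof (induction m)
    case 0
    have "(\<lambda>_. undefined) \<in> A 0" by (simp add: A_def restrict_def)
    then show ?case using A_sets[of 0] by (simp add: emeasure_return)
  next
    case (Suc m)
    have sp: "(\<lambda>_. undefined) \<in> space (?N 0)" by (simp add: space_PiM)
    have C_sets: "sets (IT.C 0 m (\<lambda>_. undefined)) = sets (?N m)"
      using IT.sets_C[OF sp, of m] by (simp only: add_0_left)
    have C_space: "space (IT.C 0 m (\<lambda>_. undefined)) = space (?N m)"
      using IT.space_C[OF sp, of m] by (simp only: add_0_left)
    have "emeasure (IT.C 0 (Suc m) (\<lambda>_. undefined)) (A (Suc m)) =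
        (\<integral>\<^sup>+x. emeasure (IT.eP m x) (A (Suc m)) \<partial>IT.C 0 m (\<lambda>_. undefined))"
      unfolding IT.C.simps add_0_left
    proof (rule emeasure_bind)
      show "space (IT.C 0 m (\<lambda>_. undefined)) \<noteq> {}"
        unfolding C_space by (simp add: space_PiM_empty_iff)
      show "IT.eP m \<in> IT.C 0 m (\<lambda>_. undefined) \<rightarrow>\<^sub>M subprob_algebra (?N (Suc m))"
        using IT.measurable_eP[of m] by (simp add: measurable_cong_sets[OF C_sets refl])
    qed (rule A_sets)
    also have "\<dots> = (\<integral>\<^sup>+x. indicator (A m) x * emeasure (mc_kernel C m h) {h m}
        \<partial>IT.C 0 m (\<lambda>_. undefined))"
    proof (rule nn_integral_cong)
      fix x assume "x \<in> space (IT.C 0 m (\<lambda>_. undefined))"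
      then have x: "x \<in> space (?N m)" by (simp only: C_space)
      then have x_ext: "x \<in> extensional {0..<m}" by (auto simp: space_PiM PiE_iff)
      have "x(m := y) \<in> A (Suc m) \<longleftrightarrow> x \<in> A m \<and> y = h m" for y
      proof
        assume "x(m := y) \<in> A (Suc m)"
        then have eq: "x(m := y) = restrict h {0..<Suc m}" by (simp add: A_def)
        have "x i = restrict h {0..<m} i" for i
          using fun_cong[OF eq, of i] x_ext by (cases "i < m") (auto simp: extensional_def)
        with fun_cong[OF eq, of m] show "x \<in> A m \<and> y = h m" by (auto simp: A_def)
      qed (auto simp: A_def)
      then have "fun_upd x m -` A (Suc m) \<inter> space (count_space UNIV) =
          (if x \<in> A m then {h m} else {})" by auto
      then have "emeasure (IT.eP m x) (A (Suc m)) =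
          emeasure (mc_kernel C m x) (if x \<in> A m then {h m} else {})"
        by (simp add: IT.emeasure_eP[OF x A_sets])
      also have "\<dots> = indicator (A m) x * emeasure (mc_kernel C m h) {h m}"
        using kernel_restrict[of m] by (auto simp: A_def)
      finally show "emeasure (IT.eP m x) (A (Suc m)) =
          indicator (A m) x * emeasure (mc_kernel C m h) {h m}" .
    qed
    also have "\<dots> = emeasure (IT.C 0 m (\<lambda>_. undefined)) (A m) * emeasure (mc_kernel C m h) {h m}"
      using A_sets[of m] unfolding C_sets[symmetric]
      by (simp only: nn_integral_multc nn_integral_indicator borel_measurable_indicator)
    finally show ?case by (simp add: Suc.IH)
  qed
  have cyl: "{\<rho>. \<forall>i\<le>n. \<rho> i = h i} = IT.PF.emb UNIV {0..<Suc n} (A (Suc n))"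
  proof (rule set_eqI)
    fix \<rho>
    have "\<rho> \<in> IT.PF.emb UNIV {0..<Suc n} (A (Suc n)) \<longleftrightarrow>
        restrict \<rho> {0..<Suc n} = restrict h {0..<Suc n}"
      by (simp add: prod_emb_def A_def)
    also have "\<dots> \<longleftrightarrow> (\<forall>i\<le>n. \<rho> i = h i)"
      by (auto simp: restrict_def fun_eq_iff less_Suc_eq_le)
    finally show "\<rho> \<in> {\<rho>. \<forall>i\<le>n. \<rho> i = h i} \<longleftrightarrow>
        \<rho> \<in> IT.PF.emb UNIV {0..<Suc n} (A (Suc n))" by simp
  qed
  have "emeasure (mc_measure C) {\<rho>. \<forall>i\<le>n. \<rho> i = h i} = emeasure (IT.CI {0..<Suc n}) (A (Suc n))"
    unfolding mc_measure_def cyl by (rule IT.lim) (simp_all add: A_sets)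
  also have "\<dots> = emeasure (IT.C 0 (Suc n) (\<lambda>_. undefined))
      (IT.PF.emb {0..<Suc n} {0..<Suc n} (A (Suc n)))"
    by (rule IT.emeasure_CI) (simp_all add: A_sets)
  also have "IT.PF.emb {0..<Suc n} {0..<Suc n} (A (Suc n)) = A (Suc n)"
    using sets.sets_into_space[OF A_sets[of "Suc n"]] by (intro prod_emb_id) (simp add: space_PiM)
  also have "emeasure (IT.C 0 (Suc n) (\<lambda>_. undefined)) (A (Suc n)) =
      ennreal (pmf (mc_init C) (h 0)) * (\<Prod>i<n. ennreal (pmf (mc_step C (h i)) (h (Suc i))))"
    unfolding C_A prod.lessThan_Suc_shift by (simp add: mc_kernel_def emeasure_pmf_single)
  also have "\<dots> = ennreal (pmf (mc_init C) (h 0) * (\<Prod>i<n. pmf (mc_step C (h i)) (h (Suc i))))"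
    by (simp add: prod_ennreal ennreal_mult prod_nonneg)
  finally show ?thesis
    by (simp add: measure_def prod_nonneg)
qed

section \<open>Markov decision processes\<close>

record ('s, 'a, 'p) mdp =
  mdp_states :: "'s set"
  mdp_acts :: "'a set"
  mdp_trans :: "'s \<Rightarrow> 'a \<Rightarrow> 's \<Rightarrow> real"
  mdp_init :: "'s \<Rightarrow> real"
  mdp_props :: "'p set"
  mdp_label :: "'s \<Rightarrow> 'p set"

text \<open>
  The functions of an MDP are total in HOL; they take the value \<open>0\<close> (respectively \<open>{}\<close>) outside
  of the carrier sets, so that an MDP is determined by its values on the carriers.
\<close>

definition is_mdp :: "('s, 'a, 'p) mdp \<Rightarrow> bool" where
  "is_mdp M \<longleftrightarrow>
     finite (mdp_states M) \<and> finite (mdp_acts M) \<and>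
     (\<forall>s a s'. mdp_trans M s a s' \<in> {0..1}) \<and>
     (\<forall>s a s'. \<not> (s \<in> mdp_states M \<and> a \<in> mdp_acts M \<and> s' \<in> mdp_states M) \<longrightarrow>
        mdp_trans M s a s' = 0) \<and>
     (\<forall>s\<in>mdp_states M. \<forall>a\<in>mdp_acts M. (\<Sum>s'\<in>mdp_states M. mdp_trans M s a s') \<in> {0, 1}) \<and>
     (\<forall>s. mdp_init M s \<in> {0..1}) \<and>
     (\<forall>s. s \<notin> mdp_states M \<longrightarrow> mdp_init M s = 0) \<and>
     (\<Sum>s\<in>mdp_states M. mdp_init M s) = 1 \<and>
     (\<forall>s\<in>mdp_states M. mdp_label M s \<subseteq> mdp_props M) \<and>
     (\<forall>s. s \<notin> mdp_states M \<longrightarrow> mdp_label M s = {})"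

definition enabled :: "('s, 'a, 'p) mdp \<Rightarrow> 's \<Rightarrow> 'a set" where
  "enabled M s = {a \<in> mdp_acts M. (\<Sum>s'\<in>mdp_states M. mdp_trans M s a s') = 1}"

text \<open>
  The history \<open>s\<^sub>0 a\<^sub>0 \<dots> s\<^sub>m a\<^sub>m s\<close> is represented by the pair
  \<open>([(s\<^sub>0, a\<^sub>0), \<dots>, (s\<^sub>m, a\<^sub>m)], s)\<close>.
\<close>

type_synonym ('s, 'a) hist = "('s \<times> 'a) list \<times> 's"
type_synonym ('s, 'a) sched = "('s, 'a) hist \<Rightarrow> 'a pmf"

definition histories :: "('s, 'a, 'p) mdp \<Rightarrow> ('s, 'a) hist set" where
  "histories M = lists (mdp_states M \<times> mdp_acts M) \<times> mdp_states M"

definition is_scheduler :: "('s, 'a, 'p) mdp \<Rightarrow> ('s, 'a) sched \<Rightarrow> bool" where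
  "is_scheduler M \<sigma> \<longleftrightarrow> (\<forall>h\<in>histories M. set_pmf (\<sigma> h) \<subseteq> enabled M (snd h))"

text \<open>
  The histories record the chosen actions: from \<open>h\<close> the chain moves to the history extended by
  \<open>a\<close> and \<open>s'\<close> with probability \<open>\<sigma>(h)(a) \<cdot> P(s, a, s')\<close>, where \<open>s\<close> is the last state of \<open>h\<close>. Hence
  the next state is \<open>s'\<close> with probability \<open>\<Sum>\<^sub>a \<sigma>(h)(a) \<cdot> P(s, a, s')\<close>, see \<open>pmf_induced_mc_state\<close>.
\<close>

definition induced_mc :: "('s, 'a, 'p) mdp \<Rightarrow> ('s, 'a) sched \<Rightarrow> (('s, 'a) hist, 'p) mc" where
  "induced_mc M \<sigma> =
     \<lparr> mc_init = map_pmf (\<lambda>s. ([], s)) (embed_pmf (mdp_init M)),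
       mc_step = (\<lambda>(h, s). bind_pmf (\<sigma> (h, s)) (\<lambda>a.
         map_pmf (\<lambda>s'. (h @ [(s, a)], s')) (embed_pmf (mdp_trans M s a)))),
       mc_label = (\<lambda>(h, s). mdp_label M s) \<rparr>"

lemma pmf_embed_pmf_finite:
  assumes "finite A" "\<And>x. f x \<ge> 0" "\<And>x. x \<notin> A \<Longrightarrow> f x = 0" "(\<Sum>x\<in>A. f x) = 1"
  shows "pmf (embed_pmf f) x = f x"
proof (rule pmf_embed_pmf)
  have "(\<integral>\<^sup>+x. ennreal (f x) \<partial>count_space UNIV) = (\<Sum>x\<in>A. ennreal (f x))"
    using assms by (intro nn_integral_count_space') auto
  also have "\<dots> = 1"
    using assms by (simp add: sum_ennreal)
  finally show "(\<integral>\<^sup>+x. ennreal (f x) \<partial>count_space UNIV) = 1" .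
qed (rule assms)

lemma pmf_mdp_trans:
  assumes M: "is_mdp M" and s: "s \<in> mdp_states M" and a: "a \<in> enabled M s"
  shows "pmf (embed_pmf (mdp_trans M s a)) s' = mdp_trans M s a s'"
  using assms by (intro pmf_embed_pmf_finite[of "mdp_states M"]) (auto simp: is_mdp_def enabled_def)

lemma pmf_mdp_init:
  assumes "is_mdp M"
  shows "pmf (embed_pmf (mdp_init M)) s = mdp_init M s"
  using assms by (intro pmf_embed_pmf_finite[of "mdp_states M"]) (auto simp: is_mdp_def)

lemma pmf_induced_mc_step:
  assumes M: "is_mdp M" and \<sigma>: "is_scheduler M \<sigma>" and hs: "(h, s) \<in> histories M"
  shows "pmf (mc_step (induced_mc M \<sigma>) (h, s)) (h @ [(s, a)], s') =
    pmf (\<sigma> (h, s)) a * mdp_trans M s a s'"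
proof -
  let ?q = "\<lambda>b. embed_pmf (mdp_trans M s b)"
  let ?f = "\<lambda>b. pmf (map_pmf (\<lambda>s'. (h @ [(s, b)], s')) (?q b)) (h @ [(s, a)], s')"
  have f_a: "?f a = pmf (?q a) s'"
    by (rule pmf_map_inj') (simp add: inj_on_def)
  have f_b: "?f b = 0" if "b \<noteq> a" for b
    using that by (intro pmf_map_outside) auto
  have "pmf (mc_step (induced_mc M \<sigma>) (h, s)) (h @ [(s, a)], s') =
      measure_pmf.expectation (\<sigma> (h, s)) ?f"
    by (simp add: induced_mc_def pmf_bind)
  also have "\<dots> = (\<Sum>b\<in>{a}. ?f b * pmf (\<sigma> (h, s)) b)"
    using f_b by (intro integral_measure_pmf_real) auto
  also have "\<dots> = pmf (\<sigma> (h, s)) a * pmf (?q a) s'"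
    by (simp add: f_a)
  also have "\<dots> = pmf (\<sigma> (h, s)) a * mdp_trans M s a s'"
  proof (cases "a \<in> set_pmf (\<sigma> (h, s))")
    case True
    have "s \<in> mdp_states M" using hs by (simp add: histories_def)
    moreover have "a \<in> enabled M s" using \<sigma> hs True by (force simp: is_scheduler_def)
    ultimately show ?thesis using M by (simp add: pmf_mdp_trans)
  qed (simp add: set_pmf_iff)
  finally show ?thesis .
qed

lemma pmf_induced_mc_state:
  assumes M: "is_mdp M" and \<sigma>: "is_scheduler M \<sigma>" and hs: "(h, s) \<in> histories M"
  shows "pmf (map_pmf snd (mc_step (induced_mc M \<sigma>) (h, s))) s' =
    (\<Sum>a\<in>mdp_acts M. pmf (\<sigma> (h, s)) a * mdp_trans M s a s')"
proof -
  let ?q = "\<lambda>b. embed_pmf (mdp_trans M s b)"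
  have s: "s \<in> mdp_states M" using hs by (simp add: histories_def)
  have supp: "set_pmf (\<sigma> (h, s)) \<subseteq> enabled M s" using \<sigma> hs by (force simp: is_scheduler_def)
  have "map_pmf snd (mc_step (induced_mc M \<sigma>) (h, s)) = bind_pmf (\<sigma> (h, s)) ?q"
    by (simp add: induced_mc_def map_bind_pmf pmf.map_comp comp_def)
  then have "pmf (map_pmf snd (mc_step (induced_mc M \<sigma>) (h, s))) s' =
      measure_pmf.expectation (\<sigma> (h, s)) (\<lambda>b. pmf (?q b) s')"
    by (simp add: pmf_bind)
  also have "\<dots> = (\<Sum>a\<in>mdp_acts M. pmf (?q a) s' * pmf (\<sigma> (h, s)) a)"
    using M supp by (intro integral_measure_pmf_real) (auto simp: is_mdp_def enabled_def)
  also have "\<dots> = (\<Sum>a\<in>mdp_acts M. pmf (\<sigma> (h, s)) a * mdp_trans M s a s')"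
  proof (rule sum.cong[OF refl])
    fix a
    show "pmf (?q a) s' * pmf (\<sigma> (h, s)) a = pmf (\<sigma> (h, s)) a * mdp_trans M s a s'"
    proof (cases "a \<in> set_pmf (\<sigma> (h, s))")
      case True
      with supp show ?thesis by (simp add: pmf_mdp_trans[OF M s] subset_iff)
    qed (simp add: set_pmf_iff)
  qed
  finally show ?thesis .
qed

section \<open>Self-composition\<close>

text \<open>
  Tuples are lists of length \<open>n\<close>; the proposition \<open>a\<close> of the \<open>j\<close>-th component is \<open>(a, j)\<close>,
  with components counted from \<open>0\<close>.
\<close>

definition tuples :: "nat \<Rightarrow> 'b set \<Rightarrow> 'b list set" where
  "tuples n A = {xs. length xs = n \<and> set xs \<subseteq> A}"

definition self_comp :: "nat \<Rightarrow> ('s, 'a, 'p) mdp \<Rightarrow> ('s list, 'a list, 'p \<times> nat) mdp" where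
  "self_comp n M =
     \<lparr> mdp_states = tuples n (mdp_states M),
       mdp_acts = tuples n (mdp_acts M),
       mdp_trans = (\<lambda>s a s'.
         if s \<in> tuples n (mdp_states M) \<and> a \<in> tuples n (mdp_acts M) \<and> s' \<in> tuples n (mdp_states M)
         then \<Prod>i<n. mdp_trans M (s ! i) (a ! i) (s' ! i) else 0),
       mdp_init = (\<lambda>s. if \<exists>x\<in>mdp_states M. s = replicate n x then mdp_init M (hd s) else 0),
       mdp_props = mdp_props M \<times> {..<n},
       mdp_label = (\<lambda>s. if s \<in> tuples n (mdp_states M)
         then {(p, j). j < n \<and> p \<in> mdp_label M (s ! j)} else {}) \<rparr>"

definition hist_proj :: "nat \<Rightarrow> ('s list, 'a list) hist \<Rightarrow> ('s, 'a) hist" where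
  "hist_proj j = (\<lambda>(h, s). (map (\<lambda>(u, a). (u ! j, a ! j)) h, s ! j))"

definition comp_sched :: "('s, 'a) sched list \<Rightarrow> ('s list, 'a list) sched" where
  "comp_sched \<sigma>s h = map_pmf (\<lambda>f. map f [0..<length \<sigma>s])
     (Pi_pmf {..<length \<sigma>s} undefined (\<lambda>j. (\<sigma>s ! j) (hist_proj j h)))"

lemma pmf_comp_sched:
  assumes "length a = length \<sigma>s"
  shows "pmf (comp_sched \<sigma>s h) a = (\<Prod>j<length \<sigma>s. pmf ((\<sigma>s ! j) (hist_proj j h)) (a ! j))"
proof -
  define n where "n = length \<sigma>s"
  define D where "D = Pi_pmf {..<n} undefined (\<lambda>j. (\<sigma>s ! j) (hist_proj j h))"
  define F where "F j = (if j < n then a ! j else undefined)" for j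
  have F: "map F [0..<n] = a"
    using assms by (intro nth_equalityI) (simp_all add: F_def n_def)
  have inj: "f = F" if "f \<in> set_pmf D" "map f [0..<n] = a" for f
  proof
    fix j
    have "f j = undefined" if "\<not> j < n"
      using \<open>f \<in> set_pmf D\<close> that set_Pi_pmf_subset[of "{..<n}"] by (fastforce simp: D_def)
    moreover have "f j = a ! j" if "j < n"
      using arg_cong[OF \<open>map f [0..<n] = a\<close>, of "\<lambda>xs. xs ! j"] that by simp
    ultimately show "f j = F j" by (simp add: F_def)
  qed
  have "pmf (comp_sched \<sigma>s h) a = measure D ((\<lambda>f. map f [0..<n]) -` {a} \<inter> set_pmf D)"
    by (simp add: comp_sched_def pmf_map D_def n_def measure_Int_set_pmf)
  also have "(\<lambda>f. map f [0..<n]) -` {a} \<inter> set_pmf D = {F} \<inter> set_pmf D"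
    using inj F by auto
  also have "measure D ({F} \<inter> set_pmf D) = pmf D F"
    by (simp add: measure_Int_set_pmf measure_pmf_single)
  also have "\<dots> = (\<Prod>j<n. pmf ((\<sigma>s ! j) (hist_proj j h)) (F j))"
    unfolding D_def by (rule pmf_Pi') (simp_all add: F_def)
  also have "\<dots> = (\<Prod>j<n. pmf ((\<sigma>s ! j) (hist_proj j h)) (a ! j))"
    by (simp add: F_def)
  finally show ?thesis by (simp add: n_def)
qed

lemma set_pmf_comp_sched:
  assumes "a \<in> set_pmf (comp_sched \<sigma>s h)"
  shows "length a = length \<sigma>s" "\<And>j. j < length \<sigma>s \<Longrightarrow> a ! j \<in> set_pmf ((\<sigma>s ! j) (hist_proj j h))"
proof -
  show len: "length a = length \<sigma>s" using assms by (auto simp: comp_sched_def)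
  have "(\<Prod>j<length \<sigma>s. pmf ((\<sigma>s ! j) (hist_proj j h)) (a ! j)) \<noteq> 0"
    using assms by (simp add: set_pmf_iff pmf_comp_sched[OF len])
  then show "a ! j \<in> set_pmf ((\<sigma>s ! j) (hist_proj j h))" if "j < length \<sigma>s" for j
    using that by (simp add: set_pmf_iff)
qed

lemma tuples_Suc: "tuples (Suc n) A = (\<lambda>(x, xs). x # xs) ` (A \<times> tuples n A)"
  by (auto simp: tuples_def length_Suc_conv image_iff)

lemma finite_tuples: "finite A \<Longrightarrow> finite (tuples n A)"
  using finite_lists_length_eq[of A n] by (simp add: tuples_def conj_commute)

lemma sum_tuples_prod:
  fixes f :: "nat \<Rightarrow> 'b \<Rightarrow> real"
  assumes "finite A"
  shows "(\<Sum>xs\<in>tuples n A. \<Prod>i<n. f i (xs ! i)) = (\<Prod>i<n. \<Sum>x\<in>A. f i x)"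
proof (induction n arbitrary: f)
  case 0
  have "tuples 0 A = {[]}" by (auto simp: tuples_def)
  then show ?case by simp
next
  case (Suc n)
  have "(\<Sum>xs\<in>tuples (Suc n) A. \<Prod>i<Suc n. f i (xs ! i)) =
      (\<Sum>(x, xs)\<in>A \<times> tuples n A. f 0 x * (\<Prod>i<n. f (Suc i) (xs ! i)))"
    unfolding tuples_Suc
    by (subst sum.reindex) (auto simp: inj_on_def prod.lessThan_Suc_shift case_prod_beta
        simp del: prod.lessThan_Suc intro!: sum.cong)
  also have "\<dots> = (\<Sum>x\<in>A. f 0 x) * (\<Sum>xs\<in>tuples n A. \<Prod>i<n. f (Suc i) (xs ! i))"
    by (simp add: sum_product sum.cartesian_product)
  also have "\<dots> = (\<Prod>i<Suc n. \<Sum>x\<in>A. f i x)"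
    by (simp add: Suc.IH[of "\<lambda>i. f (Suc i)"] prod.lessThan_Suc_shift del: prod.lessThan_Suc)
  finally show ?case .
qed

lemma sum_self_comp_trans:
  assumes "finite (mdp_states M)" "s \<in> tuples n (mdp_states M)" "a \<in> tuples n (mdp_acts M)"
  shows "(\<Sum>s'\<in>mdp_states (self_comp n M). mdp_trans (self_comp n M) s a s') =
    (\<Prod>i<n. \<Sum>x\<in>mdp_states M. mdp_trans M (s ! i) (a ! i) x)"
  using assms sum_tuples_prod[of "mdp_states M" "\<lambda>i. mdp_trans M (s ! i) (a ! i)" n]
  by (simp add: self_comp_def)

lemma tuples_nth: "xs \<in> tuples n A \<Longrightarrow> i < n \<Longrightarrow> xs ! i \<in> A"
  by (auto simp: tuples_def)

lemma is_mdp_self_comp: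
  assumes M: "is_mdp M" and n: "n \<ge> 1"
  shows "is_mdp (self_comp n M)"
proof -
  let ?S = "tuples n (mdp_states M)" and ?A = "tuples n (mdp_acts M)"
  have fin: "finite (mdp_states M)" "finite (mdp_acts M)"
    and nonneg: "mdp_trans M s a s' \<ge> 0" and le1: "mdp_trans M s a s' \<le> 1" for s a s'
    using M by (auto simp: is_mdp_def)
  have "(\<Sum>s'\<in>?S. mdp_trans (self_comp n M) s a s') \<in> {0, 1}" if "s \<in> ?S" "a \<in> ?A" for s a
  proof -
    have "(\<Sum>x\<in>mdp_states M. mdp_trans M (s ! i) (a ! i) x) \<in> {0, 1}" if "i < n" for i
      using M tuples_nth[OF \<open>s \<in> ?S\<close> that] tuples_nth[OF \<open>a \<in> ?A\<close> that] by (simp add: is_mdp_def)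
    then have "(\<Prod>i<n. \<Sum>x\<in>mdp_states M. mdp_trans M (s ! i) (a ! i) x) \<in> {0, 1}"
      by (cases "\<forall>i<n. (\<Sum>x\<in>mdp_states M. mdp_trans M (s ! i) (a ! i) x) = 1") auto
    then show ?thesis
      using sum_self_comp_trans[OF fin(1) that] by (simp add: self_comp_def)
  qed
  moreover have "mdp_trans (self_comp n M) s a s' \<in> {0..1}" for s a s'
    by (auto simp: self_comp_def intro!: prod_nonneg prod_le_1 nonneg le1)
  moreover have "(\<Sum>s\<in>?S. mdp_init (self_comp n M) s) = 1"
  proof -
    have "(\<Sum>s\<in>?S. mdp_init (self_comp n M) s) =
        (\<Sum>s\<in>replicate n ` mdp_states M. mdp_init (self_comp n M) s)"
      using finite_tuples[OF fin(1)]
      by (intro sum.mono_neutral_right) (auto simp: tuples_def self_comp_def)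
    also have "\<dots> = (\<Sum>x\<in>mdp_states M. mdp_init M x)"
      using n by (subst sum.reindex) (auto simp: inj_on_def self_comp_def replicate_eq_replicate
          intro!: sum.cong)
    finally show ?thesis using M by (simp add: is_mdp_def)
  qed
  moreover have "mdp_init (self_comp n M) s \<in> {0..1}" for s
    using M by (simp add: self_comp_def is_mdp_def)
  moreover have "mdp_init (self_comp n M) s = 0" if "s \<notin> ?S" for s
    using that by (auto simp: self_comp_def tuples_def)
  moreover have "mdp_label (self_comp n M) s \<subseteq> mdp_props (self_comp n M)" if s: "s \<in> ?S" for s
  proof
    fix q assume "q \<in> mdp_label (self_comp n M) s"
    with s obtain p j where q: "q = (p, j)" "j < n" "p \<in> mdp_label M (s ! j)"
      by (auto simp: self_comp_def)
    moreover have "mdp_label M (s ! j) \<subseteq> mdp_props M"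
      using M tuples_nth[OF s q(2)] by (simp add: is_mdp_def)
    ultimately show "q \<in> mdp_props (self_comp n M)" by (auto simp: self_comp_def)
  qed
  moreover have "mdp_trans (self_comp n M) s a s' = 0" if "\<not> (s \<in> ?S \<and> a \<in> ?A \<and> s' \<in> ?S)" for s a s'
    using that by (auto simp: self_comp_def)
  moreover have "mdp_label (self_comp n M) s = {}" if "s \<notin> ?S" for s
    using that by (simp add: self_comp_def)
  moreover have carriers: "mdp_states (self_comp n M) = ?S" "mdp_acts (self_comp n M) = ?A"
    by (simp_all add: self_comp_def)
  ultimately show ?thesis
    using finite_tuples[OF fin(1)] finite_tuples[OF fin(2)]
    unfolding is_mdp_def carriers by simp
qed

lemma is_scheduler_comp_sched:
  assumes M: "is_mdp M" and \<sigma>s: "\<forall>\<sigma>\<in>set \<sigma>s. is_scheduler M \<sigma>"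
  shows "is_scheduler (self_comp (length \<sigma>s) M) (comp_sched \<sigma>s)"
  unfolding is_scheduler_def
proof (intro ballI subsetI)
  fix h a
  let ?n = "length \<sigma>s"
  assume h: "h \<in> histories (self_comp ?n M)" and a: "a \<in> set_pmf (comp_sched \<sigma>s h)"
  obtain us s where h_eq: "h = (us, s)" by (cases h)
  have s: "s \<in> tuples ?n (mdp_states M)" using h by (simp add: h_eq histories_def self_comp_def)
  have en: "a ! j \<in> enabled M (s ! j)" if j: "j < ?n" for j
  proof -
    have "u ! j \<in> mdp_states M \<and> b ! j \<in> mdp_acts M" if "(u, b) \<in> set us" for u b
    proof -
      have "(u, b) \<in> tuples ?n (mdp_states M) \<times> tuples ?n (mdp_acts M)"
        using h that by (auto simp: h_eq histories_def self_comp_def in_lists_conv_set)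
      then show ?thesis using j by (auto intro: tuples_nth)
    qed
    moreover have "s ! j \<in> mdp_states M" using s j by (rule tuples_nth)
    ultimately have "hist_proj j h \<in> histories M"
      by (auto simp: h_eq hist_proj_def histories_def in_lists_conv_set)
    with \<sigma>s j have "set_pmf ((\<sigma>s ! j) (hist_proj j h)) \<subseteq> enabled M (snd (hist_proj j h))"
      by (auto simp: is_scheduler_def)
    moreover have "snd (hist_proj j h) = s ! j" by (simp add: h_eq hist_proj_def)
    ultimately show ?thesis using set_pmf_comp_sched(2)[OF a j] by auto
  qed
  have a_tup: "a \<in> tuples ?n (mdp_acts M)"
    using en set_pmf_comp_sched(1)[OF a] by (auto simp: tuples_def in_set_conv_nth enabled_def)
  have "finite (mdp_states M)" using M by (simp add: is_mdp_def)
  from sum_self_comp_trans[OF this s a_tup] en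
  have "(\<Sum>s'\<in>mdp_states (self_comp ?n M). mdp_trans (self_comp ?n M) s a s') = 1"
    by (simp add: enabled_def)
  with a_tup show "a \<in> enabled (self_comp ?n M) (snd h)"
    by (simp add: enabled_def h_eq self_comp_def)
qed

section \<open>The logic\<close>

datatype (ltl_props: 'p) ltl =
    LTrue
  | LProp 'p
  | LNot "'p ltl"
  | LAnd "'p ltl" "'p ltl"
  | LNext "'p ltl"
  | LUntil "'p ltl" "'p ltl"

primrec ltl_sat :: "(nat \<Rightarrow> 'p set) \<Rightarrow> 'p ltl \<Rightarrow> bool" where
  "ltl_sat w LTrue \<longleftrightarrow> True"
| "ltl_sat w (LProp p) \<longleftrightarrow> p \<in> w 0"
| "ltl_sat w (LNot \<phi>) \<longleftrightarrow> \<not> ltl_sat w \<phi>"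
| "ltl_sat w (LAnd \<phi> \<psi>) \<longleftrightarrow> ltl_sat w \<phi> \<and> ltl_sat w \<psi>"
| "ltl_sat w (LNext \<phi>) \<longleftrightarrow> ltl_sat (\<lambda>i. w (i + 1)) \<phi>"
| "ltl_sat w (LUntil \<phi> \<psi>) \<longleftrightarrow>
     (\<exists>k. ltl_sat (\<lambda>i. w (i + k)) \<psi> \<and> (\<forall>j<k. ltl_sat (\<lambda>i. w (i + j)) \<phi>))"

datatype (pexp_props: 'p) pexp =
    Prob "'p ltl"
  | Plus "'p pexp" "'p pexp"
  | Scale rat "'p pexp"

primrec pexp_val :: "('h, 'p) mc \<Rightarrow> 'p pexp \<Rightarrow> real" where
  "pexp_val C (Prob \<phi>) =
     measure (mc_measure C) {\<rho> \<in> mc_paths C. ltl_sat (\<lambda>i. mc_label C (\<rho> i)) \<phi>}"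
| "pexp_val C (Plus P Q) = pexp_val C P + pexp_val C Q"
| "pexp_val C (Scale c P) = of_rat c * pexp_val C P"

lemma sets_mc_measure: "sets (mc_measure C) = sets (PiM UNIV (\<lambda>_. count_space UNIV))"
proof -
  interpret IT: Ionescu_Tulcea "mc_kernel C" "\<lambda>_. count_space UNIV"
    by (rule Ionescu_Tulcea_mc)
  show ?thesis by (simp add: mc_measure_def)
qed

lemma space_mc_measure: "space (mc_measure C) = UNIV"
  using sets_eq_imp_space_eq[OF sets_mc_measure[of C]] by (simp add: space_PiM)

lemma sets_mc_measure_component: "{\<rho>. \<rho> k \<in> A} \<in> sets (mc_measure C)"
proof -
  have "(\<lambda>\<rho>. \<rho> k) \<in> PiM UNIV (\<lambda>_. count_space UNIV) \<rightarrow>\<^sub>M count_space UNIV"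
    by (rule measurable_component_singleton) simp
  from measurable_sets[OF this, of A] show ?thesis
    by (simp add: sets_mc_measure space_PiM vimage_def)
qed

lemma sets_mc_paths:
  fixes C :: "('h :: countable, 'p) mc"
  shows "mc_paths C \<in> sets (mc_measure C)"
proof -
  have "mc_paths C = {\<rho>. \<rho> 0 \<in> set_pmf (mc_init C)} \<inter>
      (\<Inter>i. \<Union>h. {\<rho>. \<rho> i \<in> {h}} \<inter> {\<rho>. \<rho> (Suc i) \<in> set_pmf (mc_step C h)})"
    by (auto simp: mc_paths_def)
  also have "\<dots> \<in> sets (mc_measure C)"
  proof (intro sets.Int sets.countable_INT'' sets_mc_measure_component)
    fix i
    show "(\<Union>h. {\<rho>. \<rho> i \<in> {h}} \<inter> {\<rho>. \<rho> (Suc i) \<in> set_pmf (mc_step C h)}) \<in> sets (mc_measure C)"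
      by (intro sets.countable_UN'' sets.Int sets_mc_measure_component) simp
  qed (use sets.top[of "mc_measure C"] in \<open>simp_all add: space_mc_measure\<close>)
  finally show ?thesis .
qed

lemma sets_ltl_sat: "{\<rho>. ltl_sat (\<lambda>i. mc_label C (\<rho> (i + k))) \<phi>} \<in> sets (mc_measure C)"
proof (induction \<phi> arbitrary: k)
  case (LProp p)
  then show ?case using sets_mc_measure_component[where A = "{h. p \<in> mc_label C h}"] by simp
next
  case (LNot \<phi>)
  from sets.compl_sets[OF this[of k]] show ?case
    by (simp add: space_mc_measure Compl_eq_Diff_UNIV[symmetric] Collect_neg_eq)
next
  case (LAnd \<phi> \<psi>)
  from sets.Int[OF LAnd[of k]] show ?case by (simp add: Collect_conj_eq)
next
  case (LNext \<phi>)
  from LNext[of "Suc k"] show ?case by (simp add: add.commute)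
next
  case (LUntil \<phi> \<psi>)
  have "{\<rho>. ltl_sat (\<lambda>i. mc_label C (\<rho> (i + k))) (LUntil \<phi> \<psi>)} =
     (\<Union>m. {\<rho>. ltl_sat (\<lambda>i. mc_label C (\<rho> (i + (m + k)))) \<psi>} \<inter>
       (\<Inter>j. {\<rho>. j < m \<longrightarrow> ltl_sat (\<lambda>i. mc_label C (\<rho> (i + (j + k)))) \<phi>}))"
    by (auto simp: add.assoc)
  moreover have "{\<rho>. j < m \<longrightarrow> ltl_sat (\<lambda>i. mc_label C (\<rho> (i + (j + k)))) \<phi>} \<in> sets (mc_measure C)"
    for j m
    using LUntil(1)[of "j + k"] sets.top[of "mc_measure C"]
    by (cases "j < m") (simp_all add: space_mc_measure)
  ultimately show ?case
    using LUntil(2) by (simp only:) (intro sets.countable_UN' sets.Int sets.countable_INT'', auto)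
qed (use sets.top[of "mc_measure C"] in \<open>simp add: space_mc_measure\<close>)

lemma measurable_mc_ltl:
  fixes C :: "('h :: countable, 'p) mc"
  shows "{\<rho> \<in> mc_paths C. ltl_sat (\<lambda>i. mc_label C (\<rho> i)) \<phi>} \<in> sets (mc_measure C)"
  using sets.Int[OF sets_mc_paths[of C] sets_ltl_sat[of C 0 \<phi>]] by (simp add: Collect_conj_eq)

datatype cmp = Less | Less_Eq | Greater | Greater_Eq

primrec cmp_holds :: "cmp \<Rightarrow> real \<Rightarrow> real \<Rightarrow> bool" where
  "cmp_holds Less x y \<longleftrightarrow> x < y"
| "cmp_holds Less_Eq x y \<longleftrightarrow> x \<le> y"
| "cmp_holds Greater x y \<longleftrightarrow> x > y"
| "cmp_holds Greater_Eq x y \<longleftrightarrow> x \<ge> y"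

text \<open>
  \<open>PHL n \<psi> P r c\<close> stands for
  \<open>\<exists>\<sigma>\<^sub>1 \<dots> \<exists>\<sigma>\<^sub>n. ((\<forall>\<pi>\<^sub>1:\<sigma>\<^sub>1 \<dots> \<forall>\<pi>\<^sub>n:\<sigma>\<^sub>n. \<psi>) \<and> P r c)\<close>. The proposition \<open>(a, j)\<close> denotes
  \<open>a\<close> on the path \<open>\<pi>\<^bsub>j+1\<^esub>\<close> in \<open>\<psi>\<close>, and \<open>a\<close> on the component of \<open>\<sigma>\<^bsub>j+1\<^esub>\<close> in \<open>P\<close>.
\<close>

datatype 'p phl = PHL nat "('p \<times> nat) ltl" "('p \<times> nat) pexp" cmp rat

fun closed_phl :: "'p set \<Rightarrow> 'p phl \<Rightarrow> bool" where
  "closed_phl AP (PHL n \<psi> P r c) \<longleftrightarrow>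
     n \<ge> 1 \<and> ltl_props \<psi> \<subseteq> AP \<times> {..<n} \<and> pexp_props P \<subseteq> AP \<times> {..<n}"

fun phl_sat :: "('s, 'a, 'p) mdp \<Rightarrow> 'p phl \<Rightarrow> bool" (infix \<open>\<Turnstile>\<^sub>P\<^sub>H\<^sub>L\<close> 50) where
  "M \<Turnstile>\<^sub>P\<^sub>H\<^sub>L PHL n \<psi> P r c \<longleftrightarrow>
     (\<exists>\<sigma>s. length \<sigma>s = n \<and> (\<forall>j<n. is_scheduler M (\<sigma>s ! j)) \<and>
       (\<forall>\<rho>s. length \<rho>s = n \<and> (\<forall>j<n. \<rho>s ! j \<in> mc_paths (induced_mc M (\<sigma>s ! j))) \<longrightarrow>
          ltl_sat (\<lambda>i. {(p, j). j < n \<and> p \<in> mc_label (induced_mc M (\<sigma>s ! j)) ((\<rho>s ! j) i)}) \<psi>) \<and>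
       cmp_holds r (pexp_val (induced_mc (self_comp n M) (comp_sched \<sigma>s)) P) (of_rat c))"


section \<open>Encoding of instances\<close>

text \<open>
  The inputs are MDPs with rational probabilities whose states, actions and propositions are
  numbered consecutively; every finite MDP with rational probabilities is isomorphic to such
  an MDP.
\<close>

definition mdp_input :: "(nat, nat, nat) mdp \<Rightarrow> bool" where
  "mdp_input M \<longleftrightarrow> is_mdp M \<and>
     (\<exists>N. mdp_states M = {..<N}) \<and> (\<exists>K. mdp_acts M = {..<K}) \<and> (\<exists>m. mdp_props M = {..<m}) \<and>
     (\<forall>s a s'. mdp_trans M s a s' \<in> \<rat>) \<and> (\<forall>s. mdp_init M s \<in> \<rat>)"

definition rat_code :: "rat \<Rightarrow> nat" where
  "rat_code q = prod_encode (map_prod int_encode int_encode (quotient_of q))"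

definition real_code :: "real \<Rightarrow> nat" where
  "real_code x = rat_code (THE q. of_rat q = x)"

definition mdp_code :: "(nat, nat, nat) mdp \<Rightarrow> nat" where
  "mdp_code M = (let N = card (mdp_states M); K = card (mdp_acts M) in
     list_encode
       [N, K, card (mdp_props M),
        list_encode (map (\<lambda>s. list_encode (map (\<lambda>a. list_encode (map (\<lambda>s'.
          real_code (mdp_trans M s a s')) [0..<N])) [0..<K])) [0..<N]),
        list_encode (map (\<lambda>s. real_code (mdp_init M s)) [0..<N]),
        list_encode (map (\<lambda>s. set_encode (mdp_label M s)) [0..<N])])"

primrec ltl_code :: "(nat \<times> nat) ltl \<Rightarrow> nat" where
  "ltl_code LTrue = prod_encode (0, 0)"
| "ltl_code (LProp p) = prod_encode (1, prod_encode p)"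
| "ltl_code (LNot \<phi>) = prod_encode (2, ltl_code \<phi>)"
| "ltl_code (LAnd \<phi> \<psi>) = prod_encode (3, prod_encode (ltl_code \<phi>, ltl_code \<psi>))"
| "ltl_code (LNext \<phi>) = prod_encode (4, ltl_code \<phi>)"
| "ltl_code (LUntil \<phi> \<psi>) = prod_encode (5, prod_encode (ltl_code \<phi>, ltl_code \<psi>))"

primrec pexp_code :: "(nat \<times> nat) pexp \<Rightarrow> nat" where
  "pexp_code (Prob \<phi>) = prod_encode (0, ltl_code \<phi>)"
| "pexp_code (Plus P Q) = prod_encode (1, prod_encode (pexp_code P, pexp_code Q))"
| "pexp_code (Scale c P) = prod_encode (2, prod_encode (rat_code c, pexp_code P))"

primrec cmp_code :: "cmp \<Rightarrow> nat" where
  "cmp_code Less = 0"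
| "cmp_code Less_Eq = 1"
| "cmp_code Greater = 2"
| "cmp_code Greater_Eq = 3"

primrec phl_code :: "nat phl \<Rightarrow> nat" where
  "phl_code (PHL n \<psi> P r c) =
     list_encode [n, ltl_code \<psi>, pexp_code P, cmp_code r, rat_code c]"

definition instance_code :: "(nat, nat, nat) mdp \<Rightarrow> nat phl \<Rightarrow> nat" where
  "instance_code M \<Phi> = prod_encode (mdp_code M, phl_code \<Phi>)"

lemma rat_code_inject: "rat_code p = rat_code q \<longleftrightarrow> p = q"
  using quotient_of_inject by (auto simp: rat_code_def int_encode_eq map_prod_def prod_eq_iff split: prod.splits)

lemma real_code_of_rat: "real_code (of_rat q) = rat_code q"
  by (simp add: real_code_def)

lemma real_code_inject: "x \<in> \<rat> \<Longrightarrow> y \<in> \<rat> \<Longrightarrow> real_code x = real_code y \<longleftrightarrow> x = y"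
  by (auto elim!: Rats_cases simp: real_code_of_rat rat_code_inject)

lemma ltl_code_inject: "ltl_code \<phi> = ltl_code \<psi> \<longleftrightarrow> \<phi> = \<psi>"
proof (induction \<phi> arbitrary: \<psi>)
  case LTrue then show ?case by (cases \<psi>) auto
next
  case (LProp p) then show ?case by (cases \<psi>) auto
next
  case (LNot \<phi>) then show ?case by (cases \<psi>) auto
next
  case (LAnd \<phi>1 \<phi>2) then show ?case by (cases \<psi>) auto
next
  case (LNext \<phi>) then show ?case by (cases \<psi>) auto
next
  case (LUntil \<phi>1 \<phi>2) then show ?case by (cases \<psi>) auto
qed

lemma pexp_code_inject: "pexp_code P = pexp_code Q \<longleftrightarrow> P = Q"
proof (induction P arbitrary: Q)
  case (Prob \<phi>) then show ?case by (cases Q) (auto simp: ltl_code_inject)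
next
  case (Plus P1 P2) then show ?case by (cases Q) auto
next
  case (Scale c P) then show ?case by (cases Q) (auto simp: rat_code_inject)
qed

lemma phl_code_inject: "phl_code \<Phi> = phl_code \<Psi> \<longleftrightarrow> \<Phi> = \<Psi>"
proof -
  have "cmp_code r = cmp_code r' \<longleftrightarrow> r = r'" for r r' by (cases r; cases r') simp_all
  then show ?thesis
    by (cases \<Phi>; cases \<Psi>) (auto simp: list_encode_eq ltl_code_inject pexp_code_inject rat_code_inject
        simp del: list_encode.simps)
qed

lemma mdp_code_inject:
  assumes M: "mdp_input M" and M': "mdp_input M'" and eq: "mdp_code M = mdp_code M'"
  shows "M = M'"
proof -
  have carriers: "mdp_states M = {..<card (mdp_states M)}" "mdp_acts M = {..<card (mdp_acts M)}"
    "mdp_props M = {..<card (mdp_props M)}" if "mdp_input M" for M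
    using that by (auto simp: mdp_input_def)
  note c = carriers[OF M] and c' = carriers[OF M']
  have eqs: "card (mdp_states M) = card (mdp_states M')" "card (mdp_acts M) = card (mdp_acts M')"
    "card (mdp_props M) = card (mdp_props M')"
    using eq by (auto simp: mdp_code_def Let_def list_encode_eq simp del: list_encode.simps)
  have st: "mdp_states M = mdp_states M'" "mdp_acts M = mdp_acts M'" "mdp_props M = mdp_props M'"
    using c c' eqs by simp_all
  note E = eq[unfolded mdp_code_def Let_def list_encode_eq eqs[symmetric] list.inject]
  have lt: "s < card (mdp_states M)" if "s \<in> mdp_states M" for s
    using that c by blast
  have lt': "a < card (mdp_acts M)" if "a \<in> mdp_acts M" for a
    using that c by blast
  have "mdp_trans M s a s' = mdp_trans M' s a s'" for s a s'
  proof (cases "s \<in> mdp_states M \<and> a \<in> mdp_acts M \<and> s' \<in> mdp_states M")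
    case True
    then have "real_code (mdp_trans M s a s') = real_code (mdp_trans M' s a s')"
      using E lt lt' by (auto simp: list_encode_eq map_eq_conv simp del: list_encode.simps)
    then show ?thesis using M M' by (simp add: mdp_input_def real_code_inject)
  next
    case False
    then show ?thesis using M M' st by (simp add: mdp_input_def is_mdp_def)
  qed
  moreover have "mdp_init M s = mdp_init M' s" for s
  proof (cases "s \<in> mdp_states M")
    case True
    then have "real_code (mdp_init M s) = real_code (mdp_init M' s)"
      using E lt by (auto simp: map_eq_conv)
    then show ?thesis using M M' by (simp add: mdp_input_def real_code_inject)
  next
    case False
    then show ?thesis using M M' st by (simp add: mdp_input_def is_mdp_def)
  qed
  moreover have "mdp_label M s = mdp_label M' s" for s
  proof (cases "s \<in> mdp_states M")
    case True
    then have "set_encode (mdp_label M s) = set_encode (mdp_label M' s)"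
      using E lt by (auto simp: map_eq_conv)
    moreover have "mdp_label M s \<subseteq> mdp_props M" "mdp_label M' s \<subseteq> mdp_props M"
      using M M' st True by (auto simp: mdp_input_def is_mdp_def)
    moreover have "finite (mdp_props M)" using M by (auto simp: mdp_input_def)
    ultimately show ?thesis by (simp add: finite_subset set_encode_eq)
  next
    case False
    then show ?thesis using M M' st by (simp add: mdp_input_def is_mdp_def)
  qed
  ultimately show ?thesis
    using st by (intro mdp.equality) (auto simp: fun_eq_iff)
qed

lemma instance_code_inject:
  assumes "mdp_input M" "mdp_input M'"
  shows "instance_code M \<Phi> = instance_code M' \<Phi>' \<longleftrightarrow> M = M' \<and> \<Phi> = \<Phi>'"
  using assms mdp_code_inject by (auto simp: instance_code_def phl_code_inject)


end

theory Submission
  imports Defs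
begin

text \<open>
  The universal part of a formula already suffices for undecidability; the probabilistic part is
  taken to be \<open>P(true) \<ge> 0\<close>. In the decision process used here, nature raises flags at random,
  and the times at which the flags are raised for the first time pose a question, namely a tuple of
  natural numbers. The scheduler answers it with yes or no, so that a scheduler amounts to a set of
  tuples. As all combinations of paths occur and LTL can compare the times of flags on different
  paths, \<open>\<psi>\<close> can express that the set of tuples is closed under given Horn clauses over
  \<open>0\<close> and \<open>Suc\<close>, and that it misses a given tuple. Such schedulers exist iff the tuple does not
  belong to the least model of the clauses. The graph of a partial recursive function is such a
  least model. Hence a decision procedure, composed with a program that computes the instance
  asking whether this composition fails to yield \<open>1\<close> on its own input, contradicts itself.
\<close>

section \<open>Horn clauses over the natural numbers\<close>

datatype trm = Cst nat | Var nat | SVar nat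

primrec tval :: "(nat \<Rightarrow> nat) \<Rightarrow> trm \<Rightarrow> nat" where
  "tval v (Cst c) = c"
| "tval v (Var x) = v x"
| "tval v (SVar x) = Suc (v x)"

primrec tvars :: "trm \<Rightarrow> nat set" where
  "tvars (Cst c) = {}"
| "tvars (Var x) = {x}"
| "tvars (SVar x) = {x}"

type_synonym clause = "trm list list \<times> trm list"

definition closed_under :: "nat list set \<Rightarrow> clause \<Rightarrow> bool" where
  "closed_under T c \<longleftrightarrow>
     (\<forall>v. (\<forall>A\<in>set (fst c). map (tval v) A \<in> T) \<longrightarrow> map (tval v) (snd c) \<in> T)"

text \<open>Room for a clause on \<open>k\<close> paths carrying the propositions \<open>1\<close>
  to \<open>k\<close>: one path per body atom besides those of the head and the valuation. An atom
  of length \<open>l\<close> uses propositions up to \<open>l + 1\<close>, a variable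
  \<open>x\<close> uses proposition \<open>x + 1\<close>.\<close>

definition fits :: "nat \<Rightarrow> clause \<Rightarrow> bool" where
  "fits k c \<longleftrightarrow> length (fst c) + 2 \<le> k \<and>
     (\<forall>A\<in>set (snd c # fst c). length A < k \<and> (\<forall>t\<in>set A. tvars t \<subseteq> {..<k}))"

lemma fits_mono: "fits k c \<Longrightarrow> k \<le> k' \<Longrightarrow> fits k' c"
  unfolding fits_def by (fastforce simp: subset_iff)

lemma ex_fits: "\<exists>k. fits k c"
proof -
  have "finite (\<Union>A\<in>set (snd c # fst c). \<Union>t\<in>set A. tvars t)" (is "finite ?V")
  proof (intro finite_UN_I)
    show "finite (tvars t)" for t by (cases t) auto
  qed auto
  then obtain k1 where k1: "?V \<subseteq> {..<k1}" using finite_nat_iff_bounded by blast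
  have "finite (length ` set (snd c # fst c))" (is "finite ?L") by simp
  then obtain k2 where k2: "?L \<subseteq> {..<k2}" using finite_nat_iff_bounded by blast
  have "fits (length (fst c) + 2 + k1 + k2) c"
    unfolding fits_def
  proof (intro conjI ballI subsetI)
    fix A assume A: "A \<in> set (snd c # fst c)"
    then have "length A < k2" using k2 by blast
    then show "length A < length (fst c) + 2 + k1 + k2" by simp
    fix t x assume "t \<in> set A" "x \<in> tvars t"
    then have "x < k1" using k1 A by blast
    then show "x \<in> {..<length (fst c) + 2 + k1 + k2}" by simp
  qed simp
  then show ?thesis ..
qed

lemma ex_fits_list: "\<exists>k\<ge>b. \<forall>c\<in>set P. fits k c"
proof (induction P)
  case (Cons c P)
  then obtain k where "k \<ge> b" "\<forall>c\<in>set P. fits k c" by blast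
  moreover obtain k' where "fits k' c" using ex_fits by blast
  ultimately show ?case by (intro exI[of _ "max k k'"]) (auto intro: fits_mono)
qed auto

section \<open>Recursive functions as Horn clauses\<close>

instance recf :: countable
  by countable_datatype

text \<open>Any injective numbering serves: names reach the diagonal program only inside the code of
  the rules, which it receives as input.\<close>

definition val_name :: "recf \<Rightarrow> nat" where
  "val_name g = Suc (to_nat (True, g))"

text \<open>The fact \<open>min_name g # n # xs\<close> says that \<open>g\<close> is defined and nonzero on all \<open>m # xs\<close> with
  \<open>m < n\<close>.\<close>

definition min_name :: "recf \<Rightarrow> nat" where
  "min_name g = Suc (to_nat (False, g))"

lemma names_distinct [simp]:
  "val_name f = val_name g \<longleftrightarrow> f = g" "min_name f = min_name g \<longleftrightarrow> f = g"
  "val_name f \<noteq> min_name g" "min_name f \<noteq> val_name g"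
  "val_name f \<noteq> 0" "min_name f \<noteq> 0" "0 \<noteq> val_name f" "0 \<noteq> min_name f"
  by (simp_all add: val_name_def min_name_def)

abbreviation vars :: "nat \<Rightarrow> trm list" where
  "vars m \<equiv> map Var [0..<m]"

text \<open>The second argument is the arity. Variables below \<open>m\<close> stand for parameters,
  those from \<open>m\<close> on for auxiliary values: inner and final results of a composition;
  counter, previous value and result of a recursion; the candidate of a minimisation.
  \<open>SVar (m + 1)\<close> in a body demands a nonzero value.\<close>

fun rules :: "recf \<Rightarrow> nat \<Rightarrow> clause list" where
  "rules RZero m = [([], Cst (val_name RZero) # Cst 0 # vars m)]"
| "rules RSucc m = [([], [Cst (val_name RSucc), SVar 0, Var 0])]"
| "rules (RProj i) m =
     (if i < m then [([], Cst (val_name (RProj i)) # Var i # vars m)] else [])"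
| "rules (RComp f gs) m =
     (map (\<lambda>j. Cst (val_name (gs ! j)) # Var (m + j) # vars m) [0..<length gs] @
        [Cst (val_name f) # Var (m + length gs) # map Var [m..<m + length gs]],
      Cst (val_name (RComp f gs)) # Var (m + length gs) # vars m) #
     rules f (length gs) @ concat (map (\<lambda>g. rules g m) gs)"
| "rules (RPrim g h) 0 = []"
| "rules (RPrim g h) (Suc m) =
     ([Cst (val_name g) # Var m # vars m],
      Cst (val_name (RPrim g h)) # Var m # Cst 0 # vars m) #
     ([Cst (val_name (RPrim g h)) # Var (m + 1) # Var m # vars m,
       Cst (val_name h) # Var (m + 2) # Var m # Var (m + 1) # vars m],
      Cst (val_name (RPrim g h)) # Var (m + 2) # SVar m # vars m) #
     rules g m @ rules h (m + 2)"
| "rules (RMin f) m =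
     ([], Cst (min_name f) # Cst 0 # vars m) #
     ([Cst (min_name f) # Var m # vars m,
       Cst (val_name f) # SVar (m + 1) # Var m # vars m],
      Cst (min_name f) # SVar m # vars m) #
     ([Cst (min_name f) # Var m # vars m,
       Cst (val_name f) # Cst 0 # Var m # vars m],
      Cst (val_name (RMin f)) # Var m # vars m) #
     rules f (m + 1)"

text \<open>Name \<open>0\<close> is left for the goal, that the program \<open>p\<close> evaluates to \<open>1\<close>.\<close>

definition eval_facts :: "recf \<Rightarrow> nat list set" where
  "eval_facts p =
     {0 # xs | xs. rec_eval p xs 1} \<union>
     {val_name g # y # xs | g y xs. rec_eval g xs y} \<union>
     {min_name f # n # xs | f n xs. \<forall>m<n. \<exists>y. y \<noteq> 0 \<and> rec_eval f (m # xs) y}"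

lemma val_eval_facts [simp]: "val_name g # y # xs \<in> eval_facts p \<longleftrightarrow> rec_eval g xs y"
  by (auto simp: eval_facts_def)

lemma min_eval_facts [simp]:
  "min_name f # n # xs \<in> eval_facts p \<longleftrightarrow> (\<forall>m<n. \<exists>y. y \<noteq> 0 \<and> rec_eval f (m # xs) y)"
  by (auto simp: eval_facts_def)

lemma zero_eval_facts [simp]: "0 # xs \<in> eval_facts p \<longleftrightarrow> rec_eval p xs 1"
  by (auto simp: eval_facts_def)

section \<open>Soundness of the rules\<close>

lemma closed_under_Pair:
  "closed_under T (B, H) \<longleftrightarrow>
     (\<forall>v. (\<forall>A\<in>set B. map (tval v) A \<in> T) \<longrightarrow> map (tval v) H \<in> T)"
  by (simp add: closed_under_def)

text \<open>Each clause mirrors an introduction rule of \<open>rec_eval\<close>, except two for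
  \<open>min_name\<close>, which unfold the bounded quantifier at \<open>0\<close> and at a
  successor.\<close>

lemma eval_facts_closed: "c \<in> set (rules g m) \<Longrightarrow> closed_under (eval_facts p) c"
proof (induction g m arbitrary: c rule: rules.induct)
  case (1 m)
  then show ?case by (simp add: closed_under_Pair rec_eval.zero)
next
  case (2 m)
  then show ?case by (simp add: closed_under_Pair rec_eval.succ)
next
  case (3 i m)
  have "rec_eval (RProj i) (map v [0..<m]) (v i)" if "i < m" for v
    using rec_eval.proj[of i "map v [0..<m]"] that by simp
  with 3 show ?case by (auto simp: closed_under_Pair comp_def split: if_splits)
next
  case (4 f gs m)
  have "rec_eval (RComp f gs) (map v [0..<m]) (v (m + length gs))"
    if "\<forall>j<length gs. rec_eval (gs ! j) (map v [0..<m]) (v (m + j))"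
      "rec_eval f (map v [m..<m + length gs]) (v (m + length gs))" for v
    using that by (intro rec_eval.comp[of _ gs "map v [m..<m + length gs]"])
      (auto simp: list_all2_conv_all_nth)
  \<comment> \<open>Only the first clause is new; the others belong to subprograms and fall under
    the induction hypotheses.\<close>
  then have "closed_under (eval_facts p) (hd (rules (RComp f gs) m))"
    by (auto simp: closed_under_Pair comp_def)
  with 4 show ?case by (cases c) auto
next
  case (6 g h m)
  then show ?case
    by (cases c) (auto simp: closed_under_Pair comp_def intro: rec_eval.prim_0 rec_eval.prim_Suc)
next
  case (7 f m)
  then show ?case
    by (cases c) (auto simp: closed_under_Pair comp_def less_Suc_eq rec_eval.min)
qed simp

section \<open>Completeness of the rules\<close>

lemma closed_underD:
  assumes "closed_under T (B, H)" "\<forall>A\<in>set B. map (tval v) A \<in> T"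
  shows "map (tval v) H \<in> T"
  using assms by (auto simp: closed_under_def)

lemma ex_valuation:
  obtains v where "map v [0..<length xs] = xs" "\<And>j. v (length xs + j) = zs ! j"
proof
  let ?v = "\<lambda>i. if i < length xs then xs ! i else zs ! (i - length xs)"
  show "map ?v [0..<length xs] = xs" by (intro nth_equalityI) auto
qed simp

text \<open>Induction on the evaluation, each step being one application of the matching clause.
  Thus true evaluations lie in every set closed under the rules.\<close>

lemma rec_eval_derivable:
  assumes "rec_eval g xs y" "\<forall>c\<in>set (rules g (length xs)). closed_under T c"
  shows "val_name g # y # xs \<in> T"
  using assms
proof (induction rule: rec_eval.induct)
  case (zero xs)
  then show ?case
    using closed_underD[of T "[]" _ "\<lambda>i. xs ! i"] by (fastforce simp: comp_def map_nth)
next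
  case (succ x)
  then show ?case
    using closed_underD[of T "[]" _ "\<lambda>_. x"] by fastforce
next
  case (proj i xs)
  then show ?case
    using closed_underD[of T "[]" _ "\<lambda>i. xs ! i"] by (fastforce simp: comp_def map_nth)
next
  case (comp xs gs ys f z)
  let ?m = "length xs"
  have len: "length ys = length gs" using comp.IH(1) list_all2_lengthD by fastforce
  obtain v where v0: "map v [0..<?m] = xs" and v1: "\<And>j. v (?m + j) = (ys @ [z]) ! j"
    by (rule ex_valuation[of xs "ys @ [z]"]) (rule that)
  have v: "map v [0..<?m] = xs" "map v [?m..<?m + length gs] = ys"
    "\<And>j. j < length gs \<Longrightarrow> v (?m + j) = ys ! j" "v (?m + length gs) = z"
    by (rule v0, intro nth_equalityI) (auto simp: v1 nth_append len)
  have f: "val_name f # z # ys \<in> T"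
    using comp.IH(2) comp.prems len by simp
  have gs: "val_name (gs ! j) # ys ! j # xs \<in> T" if "j < length gs" for j
    using comp.IH(1) comp.prems that by (force simp: list_all2_conv_all_nth)
  have "closed_under T (hd (rules (RComp f gs) ?m))" using comp.prems by simp
  then have "map (tval v) (Cst (val_name (RComp f gs)) # Var (?m + length gs) # vars ?m) \<in> T"
    unfolding rules.simps list.sel
  proof (rule closed_underD, intro ballI)
    fix A
    assume "A \<in> set (map (\<lambda>j. Cst (val_name (gs ! j)) # Var (?m + j) # vars ?m) [0..<length gs] @
      [Cst (val_name f) # Var (?m + length gs) # map Var [?m..<?m + length gs]])"
    then consider j where "j < length gs" "A = Cst (val_name (gs ! j)) # Var (?m + j) # vars ?m"
      | "A = Cst (val_name f) # Var (?m + length gs) # map Var [?m..<?m + length gs]"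
      by auto
    then show "map (tval v) A \<in> T"
      by cases (use f gs v in \<open>simp_all add: comp_def\<close>)
  qed
  then show ?case using v by (simp add: comp_def)
next
  case (prim_0 g xs y h)
  let ?m = "length xs"
  obtain v where v: "map v [0..<?m] = xs" "\<And>j. v (?m + j) = [y] ! j"
    by (rule ex_valuation[of xs "[y]"]) (rule that)
  note v' = v(2)[of 0, simplified]
  have "closed_under T (rules (RPrim g h) (Suc ?m) ! 0)"
    using prim_0.prems by simp
  from closed_underD[OF this[simplified], of v] prim_0
  show ?case by (auto simp: comp_def v(1) v')
next
  case (prim_Suc g h n xs y z)
  let ?m = "length xs"
  obtain v where v: "map v [0..<?m] = xs" "\<And>j. v (?m + j) = [n, y, z] ! j"
    by (rule ex_valuation[of xs "[n, y, z]"]) (rule that)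
  note v' = v(2)[of 0, simplified] v(2)[of 1, simplified] v(2)[of 2, simplified]
  have "closed_under T (rules (RPrim g h) (Suc ?m) ! 1)"
    using prim_Suc.prems by simp
  from closed_underD[OF this[simplified], of v] prim_Suc
  show ?case by (auto simp: comp_def v(1) v')
next
  case (min f n xs)
  let ?m = "length xs"
  have prems: "\<forall>c\<in>set (rules f (Suc ?m)). closed_under T c"
    "closed_under T (rules (RMin f) ?m ! 0)" "closed_under T (rules (RMin f) ?m ! 1)"
    "closed_under T (rules (RMin f) ?m ! 2)"
    using min.prems by simp_all
  \<comment> \<open>The search through smaller candidates is derived one candidate at a time, by
    induction on the bound.\<close>
  have below: "n' \<le> n \<Longrightarrow> min_name f # n' # xs \<in> T" for n'
  proof (induction n')
    case 0
    have xs: "map (\<lambda>i. xs ! i) [0..<?m] = xs" by (rule map_nth)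
    from closed_underD[OF prems(2)[simplified], of "\<lambda>i. xs ! i"] show ?case
      by (simp add: comp_def xs)
  next
    case (Suc n')
    obtain y where "y \<noteq> 0" and
      "\<forall>c\<in>set (rules f (length (n' # xs))). closed_under T c \<Longrightarrow> val_name f # y # n' # xs \<in> T"
      using min.IH(2) Suc.prems Suc_le_lessD by blast
    with prems(1) have "y \<noteq> 0" "val_name f # y # n' # xs \<in> T" by simp_all
    \<comment> \<open>The predecessor is needed as the value of the variable under
      \<open>SVar\<close>.\<close>
    then obtain y' where y: "val_name f # Suc y' # n' # xs \<in> T"
      by (cases y) auto
    obtain v where v: "map v [0..<?m] = xs" "\<And>j. v (?m + j) = [n', y'] ! j"
      by (rule ex_valuation[of xs "[n', y']"]) (rule that)
    note v' = v(2)[of 0, simplified] v(2)[of 1, simplified]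
    from closed_underD[OF prems(3)[simplified], of v] Suc.IH Suc.prems y
    show ?case by (simp add: comp_def v(1) v')
  qed
  obtain v where v: "map v [0..<?m] = xs" "\<And>j. v (?m + j) = [n] ! j"
    by (rule ex_valuation[of xs "[n]"]) (rule that)
  note v' = v(2)[of 0, simplified]
  have "val_name f # 0 # n # xs \<in> T" using min.IH(1) prems(1) by simp
  with below[of n] closed_underD[OF prems(4)[simplified], of v]
  show ?case by (simp add: comp_def v(1) v')
qed

section \<open>Programs for the pairing function and the codes of formulas\<close>

lemma rec_eval_comp1:
  "rec_eval g xs y \<Longrightarrow> rec_eval f [y] z \<Longrightarrow> rec_eval (RComp f [g]) xs z"
  by (rule rec_eval.comp[of _ _ "[y]"]) auto

lemma rec_eval_comp2:
  "rec_eval g1 xs y1 \<Longrightarrow> rec_eval g2 xs y2 \<Longrightarrow> rec_eval f [y1, y2] z \<Longrightarrow>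
    rec_eval (RComp f [g1, g2]) xs z"
  by (rule rec_eval.comp[of _ _ "[y1, y2]"]) auto

lemma rec_eval_proj: "i < length xs \<Longrightarrow> xs ! i = y \<Longrightarrow> rec_eval (RProj i) xs y"
  using rec_eval.proj by blast

lemma rec_eval_succ_comp: "rec_eval g xs y \<Longrightarrow> rec_eval (RComp RSucc [g]) xs (Suc y)"
  by (rule rec_eval_comp1[OF _ rec_eval.succ])

primrec rconst :: "nat \<Rightarrow> recf" where
  "rconst 0 = RZero"
| "rconst (Suc c) = RComp RSucc [rconst c]"

lemma rec_eval_rconst: "rec_eval (rconst c) xs c"
  by (induction c) (auto intro: rec_eval.zero rec_eval_succ_comp)

definition radd :: recf where
  "radd = RPrim (RProj 0) (RComp RSucc [RProj 1])"

lemma rec_eval_radd: "rec_eval radd [x, y] (x + y)"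
proof (induction x)
  case 0
  show ?case by (auto simp: radd_def intro!: rec_eval.prim_0 rec_eval_proj)
next
  case (Suc x)
  then have "rec_eval (RPrim (RProj 0) (RComp RSucc [RProj 1])) [Suc x, y] (Suc (x + y))"
    by (auto simp: radd_def intro!: rec_eval.prim_Suc rec_eval_succ_comp rec_eval_proj)
  then show ?case by (simp add: radd_def)
qed

definition rtriangle :: recf where
  "rtriangle = RPrim RZero (RComp radd [RProj 1, RComp RSucc [RProj 0]])"

lemma rec_eval_rtriangle: "rec_eval rtriangle [x] (triangle x)"
proof (induction x)
  case 0
  show ?case by (auto simp: rtriangle_def intro!: rec_eval.prim_0 rec_eval.zero)
next
  case (Suc x)
  have "rec_eval (RComp radd [RProj 1, RComp RSucc [RProj 0]]) [x, triangle x]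
      (triangle x + Suc x)"
    by (rule rec_eval_comp2[OF _ _ rec_eval_radd])
      (auto intro!: rec_eval_succ_comp rec_eval_proj)
  with Suc show ?case by (auto simp: rtriangle_def intro: rec_eval.prim_Suc)
qed

text \<open>\<open>prod_encode (y, z)\<close> is \<open>triangle (y + z) + y\<close>.\<close>

definition rpair :: "recf \<Rightarrow> recf \<Rightarrow> recf" where
  "rpair f g = RComp (RComp radd [RComp rtriangle [radd], RProj 0]) [f, g]"

lemma rec_eval_rpair:
  assumes "rec_eval f xs y" "rec_eval g xs z"
  shows "rec_eval (rpair f g) xs (prod_encode (y, z))"
  unfolding rpair_def
proof (rule rec_eval_comp2[OF assms])
  show "rec_eval (RComp radd [RComp rtriangle [radd], RProj 0]) [y, z] (prod_encode (y, z))"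
    unfolding prod_encode_def prod.case
    by (rule rec_eval_comp2[OF rec_eval_comp1[OF rec_eval_radd rec_eval_rtriangle] _ rec_eval_radd])
      (auto intro!: rec_eval_proj)
qed

section \<open>Facts posed by traces\<close>

definition first_at :: "(nat \<Rightarrow> 'p set) \<Rightarrow> 'p \<Rightarrow> nat \<Rightarrow> bool" where
  "first_at w p t \<longleftrightarrow> p \<in> w t \<and> (\<forall>i<t. p \<notin> w i)"

lemma first_at_unique: "first_at w p t \<Longrightarrow> first_at w p t' \<Longrightarrow> t = t'"
  unfolding first_at_def by (metis nat_neq_iff)

text \<open>The fact \<open>xs\<close> is posed by first occurrences: proposition \<open>1\<close> encodes the length of \<open>xs\<close>
  and proposition \<open>i + 2\<close> its entry \<open>i\<close>. Proposition \<open>0\<close> is the answer of the scheduler.\<close>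

definition poses :: "(nat \<Rightarrow> nat set) \<Rightarrow> nat list \<Rightarrow> bool" where
  "poses tr xs \<longleftrightarrow> first_at tr 1 (length xs) \<and> (\<forall>i<length xs. first_at tr (i + 2) (xs ! i))"

lemma poses_unique: "poses tr xs \<Longrightarrow> poses tr ys \<Longrightarrow> xs = ys"
  unfolding poses_def by (metis first_at_unique nth_equalityI)

definition accepts :: "(nat \<Rightarrow> nat set) \<Rightarrow> bool" where
  "accepts tr \<longleftrightarrow> (\<exists>t. 0 \<in> tr t)"

definition joint :: "nat \<Rightarrow> (nat \<Rightarrow> nat \<Rightarrow> nat set) \<Rightarrow> nat \<Rightarrow> (nat \<times> nat) set" where
  "joint n tr i = {(p, j). j < n \<and> p \<in> tr j i}"

lemma first_at_joint [simp]: "first_at (joint n tr) (p, j) t \<longleftrightarrow> j < n \<and> first_at (tr j) p t"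
  by (auto simp: first_at_def joint_def)

section \<open>LTL formulas about first occurrences\<close>

primrec conjf :: "'p ltl list \<Rightarrow> 'p ltl" where
  "conjf [] = LTrue"
| "conjf (f # fs) = LAnd f (conjf fs)"

lemma ltl_sat_conjf [simp]: "ltl_sat w (conjf fs) \<longleftrightarrow> (\<forall>f\<in>set fs. ltl_sat w f)"
  by (induction fs) auto

lemma ltl_props_conjf [simp]: "ltl_props (conjf fs) = (\<Union>f\<in>set fs. ltl_props f)"
  by (induction fs) auto

primrec first_const :: "'p \<Rightarrow> nat \<Rightarrow> 'p ltl" where
  "first_const p 0 = LProp p"
| "first_const p (Suc c) = LAnd (LNot (LProp p)) (LNext (first_const p c))"

text \<open>Excluding both propositions before the witness of the until makes it the first
  occurrence of each. In \<open>first_succ\<close> the witness is the first occurrence of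
  \<open>q\<close>, one instant before that of \<open>p\<close>.\<close>

definition first_same :: "'p \<Rightarrow> 'p \<Rightarrow> 'p ltl" where
  "first_same p q =
     LUntil (LAnd (LNot (LProp p)) (LNot (LProp q))) (LAnd (LProp p) (LProp q))"

definition first_succ :: "'p \<Rightarrow> 'p \<Rightarrow> 'p ltl" where
  "first_succ p q =
     LUntil (LAnd (LNot (LProp p)) (LNot (LProp q)))
       (LAnd (LNot (LProp p)) (LAnd (LProp q) (LNext (LProp p))))"

lemma ltl_sat_first_const [simp]: "ltl_sat w (first_const p c) \<longleftrightarrow> first_at w p c"
proof (induction c arbitrary: w)
  case (Suc c)
  have "(\<forall>i<Suc c. p \<notin> w i) \<longleftrightarrow> p \<notin> w 0 \<and> (\<forall>i<c. p \<notin> w (Suc i))"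
    using less_Suc_eq_0_disj by auto
  with Suc show ?case by (auto simp: first_at_def)
qed (simp add: first_at_def)

lemma ltl_sat_first_same [simp]:
  "ltl_sat w (first_same p q) \<longleftrightarrow> (\<exists>t. first_at w p t \<and> first_at w q t)"
  by (auto simp: first_same_def first_at_def)

lemma ltl_sat_first_succ [simp]:
  "ltl_sat w (first_succ p q) \<longleftrightarrow> (\<exists>t. first_at w p (Suc t) \<and> first_at w q t)"
  by (auto simp: first_succ_def first_at_def less_Suc_eq)

lemma ltl_props_first [simp]:
  "ltl_props (first_const p c) = {p}"
  "ltl_props (first_same p q) = {p, q}"
  "ltl_props (first_succ p q) = {p, q}"
  by (induction c) (auto simp: first_same_def first_succ_def)

text \<open>Path \<open>0\<close> carries the head of a clause, path \<open>1\<close> the valuation of its variables and path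
  \<open>j + 2\<close> the atom \<open>j\<close> of its body.\<close>

primrec trmf :: "nat \<times> nat \<Rightarrow> trm \<Rightarrow> (nat \<times> nat) ltl" where
  "trmf p (Cst c) = first_const p c"
| "trmf p (Var x) = first_same p (x + 1, 1)"
| "trmf p (SVar x) = first_succ p (x + 1, 1)"

definition atomf :: "nat \<Rightarrow> trm list \<Rightarrow> (nat \<times> nat) ltl" where
  "atomf j A = conjf (first_const (1, j) (length A) #
     map (\<lambda>i. trmf (i + 2, j) (A ! i)) [0..<length A])"

definition acceptf :: "nat \<Rightarrow> (nat \<times> nat) ltl" where
  "acceptf j = LUntil LTrue (LProp (0, j))"

text \<open>The path quantifiers supply the universal quantification over the variables, since path
  \<open>1\<close> ranges over all their valuations.\<close>

definition clausef :: "clause \<Rightarrow> (nat \<times> nat) ltl" where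
  "clausef c = LNot (LAnd (LAnd (atomf 0 (snd c))
     (conjf (map (\<lambda>j. LAnd (atomf (j + 2) (fst c ! j)) (acceptf (j + 2))) [0..<length (fst c)])))
     (LNot (acceptf 0)))"

text \<open>The answer of a scheduler may depend on more of the history than the fact that is posed, and
  different paths use different schedulers; hence their answers have to be related.\<close>

definition agreef :: "nat \<Rightarrow> nat \<Rightarrow> (nat \<times> nat) ltl" where
  "agreef k j = LNot (LAnd (LAnd (conjf (map (\<lambda>p. first_same (p, 0) (p, j)) [1..<k + 1]))
     (acceptf 0)) (LNot (acceptf j)))"

definition goalf :: "nat list \<Rightarrow> (nat \<times> nat) ltl" where
  "goalf g = LNot (LAnd (atomf 0 (map Cst g)) (acceptf 0))"

lemma ltl_sat_acceptf [simp]: "ltl_sat (joint n tr) (acceptf j) \<longleftrightarrow> j < n \<and> accepts (tr j)"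
  by (auto simp: acceptf_def accepts_def joint_def)

lemma ltl_sat_agreef [simp]:
  assumes "0 < n" "j < n"
  shows "ltl_sat (joint n tr) (agreef k j) \<longleftrightarrow>
    ((\<forall>p\<in>{1..k}. \<exists>t. first_at (tr 0) p t \<and> first_at (tr j) p t) \<and> accepts (tr 0) \<longrightarrow>
      accepts (tr j))"
  using assms by (auto simp: agreef_def Ball_def less_Suc_eq_le simp del: upt_Suc)

lemma ltl_sat_clausef:
  assumes "0 < n"
  shows "ltl_sat (joint n tr) (clausef c) \<longleftrightarrow>
    (ltl_sat (joint n tr) (atomf 0 (snd c)) \<and>
      (\<forall>j\<in>{0..<length (fst c)}. ltl_sat (joint n tr) (atomf (j + 2) (fst c ! j)) \<and>
        j + 2 < n \<and> accepts (tr (j + 2))) \<longrightarrow> accepts (tr 0))"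
proof -
  have "ltl_sat (joint n tr)
      (conjf (map (\<lambda>j. LAnd (atomf (j + 2) (fst c ! j)) (acceptf (j + 2))) [0..<length (fst c)])) \<longleftrightarrow>
    (\<forall>j\<in>{0..<length (fst c)}. ltl_sat (joint n tr) (atomf (j + 2) (fst c ! j)) \<and>
        j + 2 < n \<and> accepts (tr (j + 2)))"
    by simp
  then show ?thesis
    using assms unfolding clausef_def ltl_sat.simps ltl_sat_acceptf by blast
qed

text \<open>If the valuation path lacks a variable, the formulas for the terms with that variable fail,
  so its value is irrelevant.\<close>

definition valuation :: "(nat \<Rightarrow> nat set) \<Rightarrow> nat \<Rightarrow> nat" where
  "valuation tr x = (SOME t. first_at tr (x + 1) t)"

lemma valuation_eq: "first_at tr (Suc x) t \<Longrightarrow> valuation tr x = t"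
  unfolding valuation_def using first_at_unique by (metis Suc_eq_plus1 someI)

lemma trmf_first_at:
  assumes "ltl_sat (joint n tr) (trmf (p, j) t)"
  shows "first_at (tr j) p (tval (valuation (tr 1)) t)"
  using assms by (cases t) (auto simp: valuation_eq)

lemma atomf_poses:
  assumes "ltl_sat (joint n tr) (atomf j A)"
  shows "poses (tr j) (map (tval (valuation (tr 1))) A)"
  using assms unfolding atomf_def poses_def by (auto dest: trmf_first_at[of n tr "_ + 2", simplified])

lemma ltl_sat_trmf:
  assumes "1 < n" "j < n" "\<forall>x\<in>tvars t. first_at (tr 1) (x + 1) (v x)"
    "first_at (tr j) p (tval v t)"
  shows "ltl_sat (joint n tr) (trmf (p, j) t)"
  using assms by (cases t) auto

lemma ltl_sat_atomf:
  assumes "1 < n" "j < n" "\<forall>t\<in>set A. \<forall>x\<in>tvars t. first_at (tr 1) (x + 1) (v x)"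
    "poses (tr j) (map (tval v) A)"
  shows "ltl_sat (joint n tr) (atomf j A)"
proof -
  have "ltl_sat (joint n tr) (trmf (i + 2, j) (A ! i))" if "i < length A" for i
    using assms that nth_mem[OF that] by (intro ltl_sat_trmf[where v = v]) (auto simp: poses_def)
  with assms show ?thesis by (auto simp: atomf_def poses_def)
qed

section \<open>The formula of a clause set and its closed sets of facts\<close>

definition rulesf :: "nat \<Rightarrow> clause list \<Rightarrow> (nat \<times> nat) ltl" where
  "rulesf k P = conjf (map clausef P @ map (agreef k) [2..<k])"

text \<open>When acceptance means posing a fact of \<open>T\<close>, the clause and goal formulas
  express closedness and \<open>g \<notin> T\<close>. The agreement formulas hold because the first
  occurrences they compare determine the posed fact.\<close>

lemma rulesf_sound:
  assumes k: "2 \<le> k" and closed: "\<forall>c\<in>set P. closed_under T c" and g: "g \<notin> T"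
    and tr: "\<And>j. j < k \<Longrightarrow> accepts (tr j) \<longleftrightarrow> (\<exists>xs\<in>T. length xs < k \<and> poses (tr j) xs)"
    and fits: "\<forall>c\<in>set P. fits k c"
  shows "ltl_sat (joint k tr) (LAnd (rulesf k P) (goalf g))"
proof -
  have "ltl_sat (joint k tr) (clausef c)" if c: "c \<in> set P" for c
  proof -
    let ?v = "valuation (tr 1)"
    have "accepts (tr 0)" if head: "ltl_sat (joint k tr) (atomf 0 (snd c))"
      and body': "\<forall>j\<in>{0..<length (fst c)}. ltl_sat (joint k tr) (atomf (j + 2) (fst c ! j)) \<and>
        j + 2 < k \<and> accepts (tr (j + 2))"
    proof -
      note body = bspec[OF body', unfolded atLeast0LessThan lessThan_iff]
      have "map (tval ?v) A \<in> T" if A: "A \<in> set (fst c)" for A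
      proof -
        obtain j where j: "j < length (fst c)" "A = fst c ! j"
          using A by (auto simp: in_set_conv_nth)
        from body[OF j(1)] have jk: "j + 2 < k" and "accepts (tr (j + 2))" by blast+
        with tr[OF jk] obtain xs where "xs \<in> T" "poses (tr (j + 2)) xs" by blast
        moreover have "poses (tr (j + 2)) (map (tval ?v) A)"
          using atomf_poses body[OF j(1)] j(2) by blast
        ultimately show ?thesis using poses_unique by blast
      qed
      then have "map (tval ?v) (snd c) \<in> T"
        using bspec[OF closed c] unfolding closed_under_def by blast
      moreover have "length (snd c) < k" using bspec[OF fits c] by (simp add: fits_def)
      ultimately have "\<exists>xs\<in>T. length xs < k \<and> poses (tr 0) xs"
        using atomf_poses[OF head] by (intro bexI[of _ "map (tval ?v) (snd c)"]) simp_all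
      then show ?thesis using tr[of 0] k by simp
    qed
    then show ?thesis
      using ltl_sat_clausef[of k tr c] k by auto
  qed
  moreover have "ltl_sat (joint k tr) (agreef k j)" if j: "j \<in> {2..<k}" for j
  proof -
    have "accepts (tr j)" if same: "\<forall>p\<in>{1..k}. \<exists>t. first_at (tr 0) p t \<and> first_at (tr j) p t"
      and acc: "accepts (tr 0)"
    proof -
      have *: "first_at (tr j) p t" if p: "p \<in> {1..k}" and t: "first_at (tr 0) p t" for p t
        using bspec[OF same p] first_at_unique[OF t] by blast
      have "0 < k" using k by simp
      from tr[OF this] acc obtain xs where xs: "xs \<in> T" "length xs < k" "poses (tr 0) xs"
        by blast
      \<comment> \<open>As \<open>length xs < k\<close>, all propositions that pose
        \<open>xs\<close> are among \<open>1\<close> to \<open>k\<close>, where the paths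
        agree.\<close>
      have "poses (tr j) xs"
        unfolding poses_def using xs(2,3) by (auto simp: poses_def intro!: *)
      with xs show ?thesis using tr[of j] j by auto
    qed
    then show ?thesis using j by simp
  qed
  moreover have "ltl_sat (joint k tr) (goalf g)"
  proof -
    have "\<not> accepts (tr 0)" if "ltl_sat (joint k tr) (atomf 0 (map Cst g))"
    proof -
      have "poses (tr 0) g" using atomf_poses[OF that] by (simp add: comp_def)
      then have "\<not> (\<exists>xs\<in>T. length xs < k \<and> poses (tr 0) xs)"
        using g poses_unique by blast
      then show ?thesis using tr[of 0] k by simp
    qed
    then show ?thesis by (auto simp: goalf_def)
  qed
  ultimately show ?thesis
    unfolding rulesf_def ltl_sat.simps ltl_sat_conjf by (auto simp del: ltl_sat_agreef)
qed

text \<open>The formula \<^const>\<open>agreef\<close> only compares traces in which all propositions occur.\<close>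

definition full :: "nat \<Rightarrow> (nat \<Rightarrow> nat set) \<Rightarrow> bool" where
  "full k tr \<longleftrightarrow> (\<forall>p\<in>{1..k}. \<exists>t. first_at tr p t)"

text \<open>Here \<open>W j\<close> is the set of traces of scheduler \<open>j\<close>. A fact
  counts as true if every full trace of \<open>W 0\<close> posing it accepts. For a body atom one
  accepting trace on its own path suffices, and the agreement formulas provide it; the head trace
  stays arbitrary, as traces of different paths combine freely.\<close>

lemma rulesf_complete:
  fixes W :: "nat \<Rightarrow> (nat \<Rightarrow> nat set) set"
  assumes sat: "\<And>tr. (\<And>j. j < k \<Longrightarrow> tr j \<in> W j) \<Longrightarrow>
      ltl_sat (joint k tr) (LAnd (rulesf k P) (goalf g))"
    and all: "\<And>j q. j < k \<Longrightarrow> \<exists>tr\<in>W j. \<forall>p\<in>{1..k}. first_at tr p (q p)"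
    and fits: "\<forall>c\<in>set P. fits k c" and g: "length g < k" and k: "2 \<le> k"
  shows "\<exists>T. (\<forall>c\<in>set P. closed_under T c) \<and> g \<notin> T"
proof -
  define T where
    "T = {xs. length xs < k \<and> (\<forall>tr\<in>W 0. full k tr \<and> poses tr xs \<longrightarrow> accepts tr)}"
  have ex_poses: "\<exists>tr\<in>W j. full k tr \<and> poses tr xs"
    if j: "j < k" and xs: "length xs < k" for j xs
  proof -
    \<comment> \<open>Past the end of the list, \<open>!\<close> has an unspecified value; any time
      will do there, as it only has to make the trace full.\<close>
    obtain tr where tr: "tr \<in> W j" "\<forall>p\<in>{1..k}. first_at tr p ((length xs # xs) ! (p - 1))"
      using all[OF j, of "\<lambda>p. (length xs # xs) ! (p - 1)"] by blast
    have "first_at tr (i + 1) ((length xs # xs) ! i)" if "i < k" for i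
      using bspec[OF tr(2), of "i + 1"] that by simp
    from this[of 0] this[of "Suc _"] have "poses tr xs" using xs by (auto simp: poses_def)
    with tr show ?thesis by (auto simp: full_def)
  qed
  have "\<forall>j. \<exists>t. j < k \<longrightarrow> t \<in> W j" using all by blast
  \<comment> \<open>\<open>tr0\<close> fills the paths that are not under consideration.\<close>
  then obtain tr0 where tr0: "\<And>j. j < k \<Longrightarrow> tr0 j \<in> W j" by metis
  have ex_accepts: "\<exists>tr\<in>W j. poses tr xs \<and> accepts tr" if j: "2 \<le> j" "j < k" and xs: "xs \<in> T" for j xs
  proof -
    obtain t0 where t0: "t0 \<in> W 0" "full k t0" "poses t0 xs"
      using ex_poses[of 0 xs] j xs by (auto simp: T_def)
    then have acc: "accepts t0" using xs by (auto simp: T_def)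
    \<comment> \<open>\<open>tj\<close> repeats the times of \<open>t0\<close> on path
      \<open>j\<close>, so that \<open>agreef\<close> carries acceptance over.\<close>
    from t0(2) obtain q where q: "\<forall>p\<in>{1..k}. first_at t0 p (q p)"
      unfolding full_def by metis
    obtain tj where tj: "tj \<in> W j" "\<forall>p\<in>{1..k}. first_at tj p (q p)"
      using all[OF j(2), of q] by blast
    define tr where "tr = tr0(0 := t0, j := tj)"
    have tr: "tr 0 = t0" "tr j = tj" using j by (auto simp: tr_def)
    have "tr i \<in> W i" if "i < k" for i using that tr0 t0 tj by (simp add: tr_def)
    from sat[of tr, OF this] have "ltl_sat (joint k tr) (agreef k j)"
      using j by (simp add: rulesf_def del: ltl_sat_agreef)
    moreover have "\<forall>p\<in>{1..k}. \<exists>t. first_at t0 p t \<and> first_at tj p t" using q tj by blast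
    ultimately have "accepts tj" using j acc tr ltl_sat_agreef[of k j tr k] by simp
    moreover have "poses tj xs"
    proof -
      have "first_at tj p t" if "first_at t0 p t" "p \<in> {1..k}" for p t
        using q tj(2) that first_at_unique by metis
      then show ?thesis using t0(3) xs by (auto simp: poses_def T_def)
    qed
    ultimately show ?thesis using tj by blast
  qed
  have "closed_under T c" if c: "c \<in> set P" for c
    unfolding closed_under_def
  proof (intro allI impI)
    fix v
    assume body: "\<forall>A\<in>set (fst c). map (tval v) A \<in> T"
    have fc: "length (fst c) + 2 \<le> k" "length (snd c) < k"
      using bspec[OF fits c] by (simp_all add: fits_def)
    have fv: "x < k" if "A \<in> set (snd c # fst c)" "t \<in> set A" "x \<in> tvars t" for A t x
      using bspec[OF fits c] that unfolding fits_def by blast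
    have "accepts t0" if t0: "t0 \<in> W 0" "poses t0 (map (tval v) (snd c))" for t0
    proof -
      \<comment> \<open>Proposition \<open>x + 1\<close> carries the variable \<open>x\<close>,
        hence the shift.\<close>
      obtain t1 where t1: "t1 \<in> W 1" "\<forall>p\<in>{1..k}. first_at t1 p (v (p - 1))"
        using all[of 1 "\<lambda>p. v (p - 1)"] k by auto
      have "\<exists>t. \<forall>j<length (fst c). t j \<in> W (j + 2) \<and>
          poses (t j) (map (tval v) (fst c ! j)) \<and> accepts (t j)"
      proof -
        have "\<exists>t. t \<in> W (j + 2) \<and> poses t (map (tval v) (fst c ! j)) \<and> accepts t"
          if "j < length (fst c)" for j
        proof -
          have "map (tval v) (fst c ! j) \<in> T" using body that by simp
          with ex_accepts[of "j + 2"] fc(1) that show ?thesis by (simp add: Bex_def)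
        qed
        then show ?thesis by metis
      qed
      then obtain t where t: "\<And>j. j < length (fst c) \<Longrightarrow> t j \<in> W (j + 2) \<and>
          poses (t j) (map (tval v) (fst c ! j)) \<and> accepts (t j)"
        by blast
      define tr where "tr j = (if j = 0 then t0 else if j = 1 then t1
        else if j < length (fst c) + 2 then t (j - 2) else tr0 j)" for j
      have "tr j \<in> W j" if j: "j < k" for j
      proof (cases "j < 2 \<or> j \<ge> length (fst c) + 2")
        case True
        then show ?thesis using j t0 t1 tr0[OF j] by (auto simp: tr_def less_2_cases_iff)
      next
        case False
        then obtain i where "j = i + 2" using le_Suc_ex[of 2 j] by (auto simp: add.commute)
        with False show ?thesis using t[of i] by (simp add: tr_def)
      qed
      from sat[of tr, OF this] have "ltl_sat (joint k tr) (rulesf k P)" by simp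
      then have clause: "ltl_sat (joint k tr) (clausef c)"
        using c unfolding rulesf_def ltl_sat_conjf by simp
      have vars: "first_at (tr 1) (x + 1) (v x)" if "x < k" for x
        using bspec[OF t1(2), of "x + 1"] that by (simp add: tr_def)
      have "ltl_sat (joint k tr) (atomf 0 (snd c))"
      proof (rule ltl_sat_atomf[where v = v])
        show "\<forall>t\<in>set (snd c). \<forall>x\<in>tvars t. first_at (tr 1) (x + 1) (v x)"
          using fv[of "snd c"] vars by simp
      qed (use k t0 in \<open>simp_all add: tr_def\<close>)
      moreover have "\<forall>j\<in>{0..<length (fst c)}. ltl_sat (joint k tr) (atomf (j + 2) (fst c ! j)) \<and>
          j + 2 < k \<and> accepts (tr (j + 2))"
      proof (intro ballI conjI)
        fix j assume "j \<in> {0..<length (fst c)}"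
        then have j: "j < length (fst c)" by simp
        show "ltl_sat (joint k tr) (atomf (j + 2) (fst c ! j))"
        proof (rule ltl_sat_atomf[where v = v])
          show "\<forall>t\<in>set (fst c ! j). \<forall>x\<in>tvars t. first_at (tr 1) (x + 1) (v x)"
            using fv[of "fst c ! j"] vars j by simp
        qed (use k fc(1) t[OF j] j in \<open>simp_all add: tr_def\<close>)
        show "j + 2 < k" using fc(1) j by simp
        show "accepts (tr (j + 2))" using t[OF j] j by (simp add: tr_def)
      qed
      moreover have "0 < k" using k by simp
      ultimately have "accepts (tr 0)" using clause ltl_sat_clausef[of k tr c] by blast
      then show ?thesis by (simp add: tr_def)
    qed
    then show "map (tval v) (snd c) \<in> T" using fc by (auto simp: T_def)
  qed
  then have closed: "\<forall>c\<in>set P. closed_under T c" ..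
  \<comment> \<open>One full trace that poses \<open>g\<close> and does not accept refutes
    \<open>g \<in> T\<close>.\<close>
  obtain t0 where t0: "t0 \<in> W 0" "full k t0" "poses t0 g"
    using ex_poses[of 0 g] k g by auto
  have "ltl_sat (joint k (tr0(0 := t0))) (goalf g)"
    using sat[of "tr0(0 := t0)"] tr0 t0 by auto
  moreover have "ltl_sat (joint k (tr0(0 := t0))) (atomf 0 (map Cst g))"
    using k t0 by (intro ltl_sat_atomf[of _ _ _ _ undefined]) (auto simp: comp_def)
  ultimately have "\<not> accepts t0" using k by (auto simp: goalf_def)
  with t0 have "g \<notin> T" by (auto simp: T_def)
  with closed show ?thesis by blast
qed

section \<open>The decision process\<close>

text \<open>States are codes of sets of propositions \<open>\<le> k\<close>. Actions choose proposition \<open>0\<close> of the next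
  state, all other propositions are chosen uniformly at random.\<close>

definition query_trans :: "nat \<Rightarrow> nat \<Rightarrow> nat \<Rightarrow> nat \<Rightarrow> real" where
  "query_trans k s a s' =
     (if s < 2 ^ (k + 1) \<and> a < 2 \<and> s' < 2 ^ (k + 1) \<and> s' mod 2 = a then 1 / 2 ^ k else 0)"

text \<open>Bit \<open>0\<close> of a state code is its parity, so an action fixes the answer of the
  next state. Initialising as after action \<open>0\<close> leaves the first state without an
  answer.\<close>

definition query_mdp :: "nat \<Rightarrow> (nat, nat, nat) mdp" where
  "query_mdp k =
     \<lparr> mdp_states = {..<2 ^ (k + 1)}, mdp_acts = {..<2}, mdp_trans = query_trans k,
       mdp_init = query_trans k 0 0, mdp_props = {..<k + 1},
       mdp_label = (\<lambda>s. if s < 2 ^ (k + 1) then set_decode s else {}) \<rparr>"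

lemma query_mdp_simps [simp]:
  "mdp_states (query_mdp k) = {..<2 ^ (k + 1)}"
  "mdp_acts (query_mdp k) = {..<2}"
  "mdp_trans (query_mdp k) = query_trans k"
  "mdp_init (query_mdp k) = query_trans k 0 0"
  "mdp_props (query_mdp k) = {..<k + 1}"
  "mdp_label (query_mdp k) s = (if s < 2 ^ (k + 1) then set_decode s else {})"
  by (simp_all add: query_mdp_def)

lemma sum_parity:
  fixes a n :: nat and c :: real
  shows "a < 2 \<Longrightarrow> (\<Sum>s<2 * n. if s mod 2 = a then c else 0) = real n * c"
proof (induction n)
  case (Suc n)
  then have "a = 0 \<or> a = 1" by auto
  with Suc show ?case by (auto simp: algebra_simps)
qed simp

lemma sum_query_trans:
  assumes "s < 2 ^ (k + 1)" "a < 2"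
  shows "(\<Sum>s'<2 ^ (k + 1). query_trans k s a s') = 1"
proof -
  have "(\<Sum>s'<2 ^ (k + 1). query_trans k s a s') =
      (\<Sum>s'<2 * 2 ^ k. if s' mod 2 = a then 1 / 2 ^ k else (0::real))"
    using assms by (intro sum.cong) (auto simp: query_trans_def)
  then show ?thesis using sum_parity[OF assms(2), of "1 / 2 ^ k" "2 ^ k"] by simp
qed

lemma set_decode_less: "s < 2 ^ n \<Longrightarrow> set_decode s \<subseteq> {..<n}"
proof
  fix i assume s: "s < 2 ^ n" and "i \<in> set_decode s"
  then have "0 < s div 2 ^ i" by (intro odd_pos) (simp add: set_decode_def)
  then have "2 ^ i \<le> s" by (simp add: div_greater_zero_iff)
  then have "(2::nat) ^ i < 2 ^ n" using s by (rule order.strict_trans1)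
  then show "i \<in> {..<n}" by simp
qed

lemma set_encode_less:
  assumes "S \<subseteq> {..<n}"
  shows "set_encode S < 2 ^ n"
proof -
  have "set_encode S \<le> set_encode {..<n}"
    unfolding set_encode_def using assms by (intro sum_mono2) auto
  also have "\<dots> < 2 ^ n"
    by (induction n) (simp_all add: set_encode_def lessThan_Suc)
  finally show ?thesis .
qed

lemma is_mdp_query_mdp: "is_mdp (query_mdp k)"
proof -
  have "(1::real) / 2 ^ k \<le> 1" by simp
  then have "query_trans k s a s' \<in> {0..1}" for s a s' by (simp add: query_trans_def)
  moreover have "query_trans k s a s' = 0"
    if "\<not> (s < 2 ^ (k + 1) \<and> a < 2 \<and> s' < 2 ^ (k + 1))" for s a s'
    using that by (auto simp: query_trans_def)
  moreover have "(\<Sum>s'<2 ^ (k + 1). query_trans k s a s') = 1" if "s < 2 ^ (k + 1)" "a < 2" for s a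
    using that by (rule sum_query_trans)
  ultimately show ?thesis
    using set_decode_less[of _ "k + 1"]
    by (auto simp: is_mdp_def simp del: power_Suc power_add)
qed

lemma mdp_input_query_mdp: "mdp_input (query_mdp k)"
  using is_mdp_query_mdp by (auto simp: mdp_input_def query_trans_def)

lemma enabled_query_mdp: "s < 2 ^ (k + 1) \<Longrightarrow> enabled (query_mdp k) s = {..<2}"
  using sum_query_trans[of s k] by (auto simp: enabled_def)

lemma set_pmf_query_trans:
  assumes "s < 2 ^ (k + 1)" "a < 2"
  shows "set_pmf (embed_pmf (query_trans k s a)) = {s'. s' < 2 ^ (k + 1) \<and> s' mod 2 = a}"
proof -
  have "pmf (embed_pmf (query_trans k s a)) s' = query_trans k s a s'" for s'
    using pmf_mdp_trans[OF is_mdp_query_mdp, of s k a s'] assms by (simp add: enabled_query_mdp)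
  with assms show ?thesis by (auto simp: set_pmf_eq query_trans_def)
qed

section \<open>Paths and traces of the decision process\<close>

abbreviation query_mc :: "nat \<Rightarrow> (nat, nat) sched \<Rightarrow> ((nat, nat) hist, nat) mc" where
  "query_mc k \<sigma> \<equiv> induced_mc (query_mdp k) \<sigma>"

definition trace :: "nat \<Rightarrow> (nat \<Rightarrow> (nat, nat) hist) \<Rightarrow> nat \<Rightarrow> nat set" where
  "trace k \<rho> i = mdp_label (query_mdp k) (snd (\<rho> i))"

definition traces :: "nat \<Rightarrow> (nat, nat) sched \<Rightarrow> (nat \<Rightarrow> nat set) set" where
  "traces k \<sigma> = trace k ` mc_paths (query_mc k \<sigma>)"

lemma set_pmf_init:
  "set_pmf (mc_init (query_mc k \<sigma>)) = {([], s) | s. s < 2 ^ (k + 1) \<and> even s}"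
  using set_pmf_query_trans[of 0 k 0] by (auto simp: induced_mc_def even_iff_mod_2_eq_zero)

lemma set_pmf_step:
  assumes "is_scheduler (query_mdp k) \<sigma>" "(h, s) \<in> histories (query_mdp k)"
  shows "set_pmf (mc_step (query_mc k \<sigma>) (h, s)) =
    {(h @ [(s, a)], s') | a s'. a \<in> set_pmf (\<sigma> (h, s)) \<and> s' < 2 ^ (k + 1) \<and> s' mod 2 = a}"
proof -
  have s: "s < 2 ^ (k + 1)" using assms by (simp add: histories_def)
  have a: "a < 2" if "a \<in> set_pmf (\<sigma> (h, s))" for a
    using assms that enabled_query_mdp[OF s] by (force simp: is_scheduler_def)
  show ?thesis
    using set_pmf_query_trans[OF s a] by (auto simp: induced_mc_def)
qed

text \<open>Histories contain all earlier states, so a scheduler sees the trace up to the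
  present.\<close>

lemma path_history:
  assumes "is_scheduler (query_mdp k) \<sigma>" "\<rho> \<in> mc_paths (query_mc k \<sigma>)"
  shows "\<rho> i \<in> histories (query_mdp k) \<and>
    map fst (fst (\<rho> i)) @ [snd (\<rho> i)] = map (snd \<circ> \<rho>) [0..<Suc i]"
proof (induction i)
  case 0
  have "\<rho> 0 \<in> set_pmf (mc_init (query_mc k \<sigma>))" using assms by (simp add: mc_paths_def)
  then show ?case by (auto simp: set_pmf_init histories_def)
next
  case (Suc i)
  obtain h s where hs: "\<rho> i = (h, s)" by (cases "\<rho> i")
  then have hist: "(h, s) \<in> histories (query_mdp k)" using Suc by simp
  have "\<rho> (Suc i) \<in> set_pmf (mc_step (query_mc k \<sigma>) (h, s))"
    using assms hs by (auto simp: mc_paths_def dest: spec[of _ i])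
  then obtain a s' where a: "\<rho> (Suc i) = (h @ [(s, a)], s')" "a \<in> set_pmf (\<sigma> (h, s))"
    "s' < 2 ^ (k + 1)" "s' mod 2 = a"
    unfolding set_pmf_step[OF assms(1) hist] by blast
  moreover have "a < 2" using a(4) by auto
  ultimately show ?case using Suc hist hs by (auto simp: histories_def)
qed

text \<open>After every enabled action each set of flags among \<open>1\<close> to \<open>k\<close>
  has positive probability, so nature can realise any times against any scheduler.\<close>

lemma ex_trace:
  assumes \<sigma>: "is_scheduler (query_mdp k) \<sigma>"
  shows "\<exists>tr\<in>traces k \<sigma>. \<forall>p\<in>{1..k}. first_at tr p (q p)"
proof -
  \<comment> \<open>\<open>F i\<close> are the flags due at time \<open>i\<close>, and
    \<open>S i a\<close> is the state that adds the answer \<open>a\<close> to them. The path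
    follows some action from the support of \<open>\<sigma>\<close>, which shows as the answer one
    instant later.\<close>
  define F where "F i = {p\<in>{1..k}. q p = i}" for i
  define S where "S i a = set_encode (F i \<union> (if a = 1 then {0} else {}))" for i and a :: nat
  define act where "act hs = (SOME a. a \<in> set_pmf (\<sigma> hs))" for hs
  define \<rho> where "\<rho> = rec_nat ([], S 0 0) (\<lambda>i hs. (fst hs @ [(snd hs, act hs)], S (Suc i) (act hs)))"
  have \<rho>: "\<rho> 0 = ([], S 0 0)"
    "\<rho> (Suc i) = (fst (\<rho> i) @ [(snd (\<rho> i), act (\<rho> i))], S (Suc i) (act (\<rho> i)))" for i
    by (simp_all add: \<rho>_def)
  have act: "act hs \<in> set_pmf (\<sigma> hs)" for hs
    by (simp add: act_def some_in_eq set_pmf_not_empty)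
  have decode: "set_decode (S i a) = F i \<union> (if a = 1 then {0} else {})" for i a
    by (simp add: S_def F_def)
  have S_less: "S i a < 2 ^ (k + 1)" for i a
    unfolding S_def by (rule set_encode_less) (auto simp: F_def)
  have S_mod: "S i a mod 2 = a" if "a < 2" for i a
  proof -
    have "odd (S i a) \<longleftrightarrow> 0 \<in> set_decode (S i a)" by simp
    also have "\<dots> \<longleftrightarrow> a = 1" unfolding decode by (simp add: F_def)
    finally have "odd (S i a) \<longleftrightarrow> a = 1" .
    with that show ?thesis by (cases "a = 1") (auto simp: odd_iff_mod_2_eq_one)
  qed
  have act_less: "act hs < 2" if "hs \<in> histories (query_mdp k)" for hs
  proof -
    have "snd hs < 2 ^ (k + 1)" using that by (auto simp: histories_def)
    then show ?thesis
      using act[of hs] \<sigma> that enabled_query_mdp by (fastforce simp: is_scheduler_def)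
  qed
  have hist: "\<rho> i \<in> histories (query_mdp k)" for i
  proof (induction i)
    case 0
    then show ?case using S_less by (simp add: \<rho> histories_def)
  next
    case (Suc i)
    then show ?case using S_less act_less[OF Suc] by (auto simp: \<rho> histories_def)
  qed
  have "\<rho> 0 \<in> set_pmf (mc_init (query_mc k \<sigma>))"
    using S_less[of 0 0] S_mod[of 0 0] by (auto simp: \<rho> set_pmf_init)
  moreover have "\<rho> (Suc i) \<in> set_pmf (mc_step (query_mc k \<sigma>) (\<rho> i))" for i
  proof (cases "\<rho> i")
    case (Pair h s)
    with hist[of i] act_less[OF hist[of i]] act[of "\<rho> i"] show ?thesis
      using \<rho>(2)[of i] S_less S_mod by (simp add: set_pmf_step[OF \<sigma>])
  qed
  ultimately have "\<rho> \<in> mc_paths (query_mc k \<sigma>)" by (simp add: mc_paths_def)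
  moreover have "p \<in> trace k \<rho> i \<longleftrightarrow> q p = i" if "p \<in> {1..k}" for p i
  proof -
    have "\<exists>a. snd (\<rho> i) = S i a" by (cases i) (auto simp: \<rho>)
    then obtain a where "snd (\<rho> i) = S i a" ..
    then show ?thesis using that S_less[of i a] decode[of i a] by (auto simp: trace_def F_def)
  qed
  ultimately show ?thesis
    unfolding traces_def by (intro bexI[of _ "trace k \<rho>"]) (auto simp: first_at_def)
qed

section \<open>The scheduler that answers by membership in a set\<close>

definition truncate :: "nat \<Rightarrow> (nat \<Rightarrow> nat set) \<Rightarrow> nat \<Rightarrow> nat set" where
  "truncate n tr i = (if i < n then tr i else {})"

lemma first_at_truncate: "first_at (truncate n tr) p t \<longleftrightarrow> t < n \<and> first_at tr p t"
  by (auto simp: first_at_def truncate_def)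

lemma ex_poses_truncate: "(\<exists>n. poses (truncate (Suc n) tr) xs) \<longleftrightarrow> poses tr xs"
proof
  assume "poses tr xs"
  \<comment> \<open>\<open>length xs + sum_list xs\<close> bounds the first occurrences of all
    propositions that pose \<open>xs\<close>.\<close>
  then have "poses (truncate (Suc (length xs + sum_list xs)) tr) xs"
    by (auto simp: poses_def first_at_truncate less_Suc_eq_le
        intro: order.trans[OF member_le_sum_list le_add2])
  then show "\<exists>n. poses (truncate (Suc n) tr) xs" ..
qed (auto simp: poses_def first_at_truncate)

text \<open>\<open>T\<close> may be any set, as schedulers need not be computable. The observed
  prefix decides whether a fact of \<open>T\<close> has been posed by now.\<close>

definition answer_sched :: "nat \<Rightarrow> nat list set \<Rightarrow> (nat, nat) sched" where
  "answer_sched k T hs = (let L = map fst (fst hs) @ [snd hs] in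
     return_pmf (if \<exists>xs\<in>T. length xs < k \<and>
         poses (truncate (length L) (\<lambda>i. mdp_label (query_mdp k) (L ! i))) xs then 1 else 0))"

lemma is_scheduler_answer_sched: "is_scheduler (query_mdp k) (answer_sched k T)"
  by (auto simp: is_scheduler_def histories_def answer_sched_def enabled_query_mdp Let_def)

text \<open>A fact is posed within finitely many instants, so a scheduler that sees only prefixes
  still answers yes at some time.\<close>

lemma traces_answer_sched:
  assumes "tr \<in> traces k (answer_sched k T)"
  shows "accepts tr \<longleftrightarrow> (\<exists>xs\<in>T. length xs < k \<and> poses tr xs)"
proof -
  note \<sigma> = is_scheduler_answer_sched[of k T]
  obtain \<rho> where \<rho>: "\<rho> \<in> mc_paths (query_mc k (answer_sched k T))" "tr = trace k \<rho>"
    using assms by (auto simp: traces_def)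
  have "\<rho> 0 \<in> set_pmf (mc_init (query_mc k (answer_sched k T)))"
    using \<rho> by (simp add: mc_paths_def)
  then have "0 \<notin> tr 0" by (auto simp: \<rho> trace_def set_pmf_init)
  \<comment> \<open>The answer at \<open>Suc i\<close> was chosen after seeing the states
    \<open>0\<close> to \<open>i\<close>, that is, \<open>Suc i\<close> of them.\<close>
  moreover have "0 \<in> tr (Suc i) \<longleftrightarrow> (\<exists>xs\<in>T. length xs < k \<and> poses (truncate (Suc i) tr) xs)" for i
  proof -
    obtain h s where hs: "\<rho> i = (h, s)" by (cases "\<rho> i")
    have hist: "(h, s) \<in> histories (query_mdp k)" and
      L: "map fst h @ [s] = map (snd \<circ> \<rho>) [0..<Suc i]"
      using path_history[OF \<sigma> \<rho>(1), of i] hs by simp_all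
    have tr: "truncate (length (map fst h @ [s]))
        (\<lambda>j. mdp_label (query_mdp k) ((map fst h @ [s]) ! j)) = truncate (Suc i) tr"
      unfolding L by (auto simp: truncate_def \<rho> trace_def fun_eq_iff simp del: upt_Suc)
    have "\<rho> (Suc i) \<in> set_pmf (mc_step (query_mc k (answer_sched k T)) (h, s))"
      using \<rho>(1) hs by (auto simp: mc_paths_def dest: spec[of _ i])
    then obtain a s' where a: "snd (\<rho> (Suc i)) = s'" "s' < 2 ^ (k + 1)" "s' mod 2 = a"
      "a \<in> set_pmf (answer_sched k T (h, s))"
      unfolding set_pmf_step[OF \<sigma> hist] by auto
    then have "0 \<in> tr (Suc i) \<longleftrightarrow> a = 1"
      by (simp add: \<rho> trace_def odd_iff_mod_2_eq_one)
    also have "\<dots> \<longleftrightarrow> (\<exists>xs\<in>T. length xs < k \<and> poses (truncate (Suc i) tr) xs)"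
      using a(4) unfolding answer_sched_def Let_def fst_conv snd_conv tr by (simp split: if_splits)
    finally show ?thesis .
  qed
  ultimately have "accepts tr \<longleftrightarrow> (\<exists>i. \<exists>xs\<in>T. length xs < k \<and> poses (truncate (Suc i) tr) xs)"
    unfolding accepts_def by (metis not0_implies_Suc)
  then show ?thesis using ex_poses_truncate by blast
qed

section \<open>From clauses to PHL formulas\<close>

definition rules_phl :: "nat \<Rightarrow> clause list \<Rightarrow> nat list \<Rightarrow> nat phl" where
  "rules_phl k P g = PHL k (LAnd (rulesf k P) (goalf g)) (Prob LTrue) Greater_Eq 0"

lemma joint_traces:
  assumes "\<And>j. j < n \<Longrightarrow> tr j = trace k (\<rho> j)"
  shows "(\<lambda>i. {(p, j). j < n \<and> p \<in> mc_label (query_mc k (\<sigma> j)) (\<rho> j i)}) = joint n tr"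
  using assms by (auto simp: joint_def trace_def induced_mc_def case_prod_beta fun_eq_iff
      split: if_splits)

lemma phl_sat_rules_phl:
  assumes k: "2 \<le> k" and fits: "\<forall>c\<in>set P. fits k c" and g: "length g < k"
  shows "query_mdp k \<Turnstile>\<^sub>P\<^sub>H\<^sub>L rules_phl k P g \<longleftrightarrow>
    (\<exists>T. (\<forall>c\<in>set P. closed_under T c) \<and> g \<notin> T)"
proof
  assume "query_mdp k \<Turnstile>\<^sub>P\<^sub>H\<^sub>L rules_phl k P g"
  then obtain \<sigma>s where sched: "\<And>j. j < k \<Longrightarrow> is_scheduler (query_mdp k) (\<sigma>s ! j)"
    and sat: "\<And>\<rho>s. length \<rho>s = k \<Longrightarrow> (\<And>j. j < k \<Longrightarrow> \<rho>s ! j \<in> mc_paths (query_mc k (\<sigma>s ! j))) \<Longrightarrow>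
      ltl_sat (\<lambda>i. {(p, j). j < k \<and> p \<in> mc_label (query_mc k (\<sigma>s ! j)) ((\<rho>s ! j) i)})
        (LAnd (rulesf k P) (goalf g))"
    unfolding rules_phl_def phl_sat.simps by blast
  show "\<exists>T. (\<forall>c\<in>set P. closed_under T c) \<and> g \<notin> T"
  \<comment> \<open>\<open>W j\<close> becomes the set of traces of the scheduler
    \<open>\<sigma>s ! j\<close>; the path quantifiers cover all combinations of them.\<close>
  proof (rule rulesf_complete[OF _ _ fits g k])
    show "\<exists>tr\<in>traces k (\<sigma>s ! j). \<forall>p\<in>{1..k}. first_at tr p (q p)" if "j < k" for j q
      using ex_trace[OF sched[OF that]] .
    fix tr assume "\<And>j. j < k \<Longrightarrow> tr j \<in> traces k (\<sigma>s ! j)"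
    then have "\<forall>j. \<exists>\<rho>. j < k \<longrightarrow> \<rho> \<in> mc_paths (query_mc k (\<sigma>s ! j)) \<and> tr j = trace k \<rho>"
      unfolding traces_def by blast
    then obtain \<rho> where \<rho>:
      "\<And>j. j < k \<Longrightarrow> \<rho> j \<in> mc_paths (query_mc k (\<sigma>s ! j)) \<and> tr j = trace k (\<rho> j)"
      by metis
    have "joint k tr =
      (\<lambda>i. {(p, j). j < k \<and> p \<in> mc_label (query_mc k (\<sigma>s ! j)) ((map \<rho> [0..<k] ! j) i)})"
      by (rule joint_traces[symmetric]) (simp add: \<rho>)
    then show "ltl_sat (joint k tr) (LAnd (rulesf k P) (goalf g))"
      using sat[of "map \<rho> [0..<k]"] \<rho> by simp
  qed
next
  assume "\<exists>T. (\<forall>c\<in>set P. closed_under T c) \<and> g \<notin> T"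
  then obtain T where T: "\<forall>c\<in>set P. closed_under T c" "g \<notin> T" by blast
  \<comment> \<open>The same scheduler serves all paths.\<close>
  let ?\<sigma>s = "replicate k (answer_sched k T)"
  have "ltl_sat (\<lambda>i. {(p, j). j < k \<and> p \<in> mc_label (query_mc k (?\<sigma>s ! j)) ((\<rho>s ! j) i)})
      (LAnd (rulesf k P) (goalf g))"
    if \<rho>s: "\<forall>j<k. \<rho>s ! j \<in> mc_paths (query_mc k (?\<sigma>s ! j))" for \<rho>s
    unfolding joint_traces[of k "\<lambda>j. trace k (\<rho>s ! j)" k "\<lambda>j. \<rho>s ! j" "\<lambda>j. ?\<sigma>s ! j", OF refl]
  proof (rule rulesf_sound[OF k T _ fits])
    fix j assume "j < k"
    with \<rho>s have "trace k (\<rho>s ! j) \<in> traces k (answer_sched k T)" by (auto simp: traces_def)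
    then show "accepts (trace k (\<rho>s ! j)) \<longleftrightarrow>
        (\<exists>xs\<in>T. length xs < k \<and> poses (trace k (\<rho>s ! j)) xs)"
      by (rule traces_answer_sched)
  qed
  then show "query_mdp k \<Turnstile>\<^sub>P\<^sub>H\<^sub>L rules_phl k P g"
    unfolding rules_phl_def phl_sat.simps
    by (intro exI[of _ ?\<sigma>s] conjI allI impI) (simp_all add: is_scheduler_answer_sched)
qed

lemma ltl_props_atomf:
  assumes "length A < k" "\<forall>t\<in>set A. tvars t \<subseteq> {..<k}" "j < k" "2 \<le> k"
  shows "ltl_props (atomf j A) \<subseteq> {..<k + 1} \<times> {..<k}"
proof -
  have "ltl_props (trmf (i + 2, j) (A ! i)) \<subseteq> {..<k + 1} \<times> {..<k}" if "i < length A" for i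
    using assms(1,3,4) bspec[OF assms(2) nth_mem[OF that]] that by (cases "A ! i") auto
  then show ?thesis using assms by (simp add: atomf_def UN_subset_iff)
qed

lemma closed_rules_phl:
  assumes k: "2 \<le> k" and fits: "\<forall>c\<in>set P. fits k c" and g: "length g < k"
  shows "closed_phl (mdp_props (query_mdp k)) (rules_phl k P g)"
proof -
  let ?X = "{..<k + 1} \<times> {..<k}"
  have acceptf: "ltl_props (acceptf j) \<subseteq> ?X" if "j < k" for j
    using that by (simp add: acceptf_def)
  have "ltl_props (clausef c) \<subseteq> ?X" if c: "c \<in> set P" for c
  proof -
    have f: "length (fst c) + 2 \<le> k"
      "\<And>A. A \<in> set (snd c # fst c) \<Longrightarrow> length A < k \<and> (\<forall>t\<in>set A. tvars t \<subseteq> {..<k})"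
      using bspec[OF fits c] unfolding fits_def by blast+
    have "ltl_props (atomf 0 (snd c)) \<subseteq> ?X"
      using f(2)[of "snd c"] k by (intro ltl_props_atomf) auto
    moreover have "ltl_props (atomf (j + 2) (fst c ! j)) \<subseteq> ?X" if "j < length (fst c)" for j
      using f(1) f(2)[of "fst c ! j"] k that by (intro ltl_props_atomf) auto
    moreover have "ltl_props (acceptf (j + 2)) \<subseteq> ?X" if "j < length (fst c)" for j
      using f(1) that by (intro acceptf) simp
    moreover have "ltl_props (acceptf 0) \<subseteq> ?X" using k by (intro acceptf) simp
    ultimately show ?thesis by (simp add: clausef_def UN_subset_iff)
  qed
  moreover have "ltl_props (agreef k j) \<subseteq> ?X" if "j \<in> {2..<k}" for j
    using acceptf[of 0] acceptf[of j] that by (auto simp: agreef_def)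
  moreover have "ltl_props (goalf g) \<subseteq> ?X"
    using ltl_props_atomf[of "map Cst g" k 0] acceptf[of 0] k g by (simp add: goalf_def)
  ultimately show ?thesis
    using k by (simp add: rules_phl_def rulesf_def UN_subset_iff)
qed

section \<open>Diagonalisation\<close>

definition rcons :: "recf \<Rightarrow> recf \<Rightarrow> recf" where
  "rcons f g = RComp RSucc [rpair f g]"

text \<open>The constants \<open>3\<close>, here, and \<open>2\<close> and \<open>4\<close>, below,
  are the tags of \<open>LAnd\<close>, \<open>LNot\<close> and \<open>LNext\<close> in
  \<open>ltl_code\<close>.\<close>

definition rconj :: "recf \<Rightarrow> recf \<Rightarrow> recf" where
  "rconj f g = rpair (rconst 3) (rpair f g)"

definition rnot :: "recf \<Rightarrow> recf" where
  "rnot f = rpair (rconst 2) f"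

definition rformula :: "(nat \<times> nat) ltl \<Rightarrow> recf" where
  "rformula \<phi> = rconst (ltl_code \<phi>)"

text \<open>Primitive recursion on the constant; \<open>RProj 1\<close> is the code for the
  preceding constant.\<close>

definition rfirst_const :: "nat \<times> nat \<Rightarrow> recf" where
  "rfirst_const p = RPrim (rformula (LProp p))
     (rconj (rformula (LNot (LProp p))) (rpair (rconst 4) (RProj 1)))"

lemma rec_eval_rcons:
  "rec_eval f xs x \<Longrightarrow> rec_eval g xs (list_encode ys) \<Longrightarrow>
    rec_eval (rcons f g) xs (list_encode (x # ys))"
  by (simp add: rcons_def rec_eval_succ_comp rec_eval_rpair)

lemma rec_eval_rconj:
  "rec_eval f xs (ltl_code \<phi>) \<Longrightarrow> rec_eval g xs (ltl_code \<psi>) \<Longrightarrow>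
    rec_eval (rconj f g) xs (ltl_code (LAnd \<phi> \<psi>))"
  by (simp add: rconj_def rec_eval_rpair rec_eval_rconst)

lemma rec_eval_rnot:
  "rec_eval f xs (ltl_code \<phi>) \<Longrightarrow> rec_eval (rnot f) xs (ltl_code (LNot \<phi>))"
  by (simp add: rnot_def rec_eval_rpair rec_eval_rconst)

lemma rec_eval_rformula: "rec_eval (rformula \<phi>) xs (ltl_code \<phi>)"
  by (simp add: rformula_def rec_eval_rconst)

lemma rec_eval_rfirst_const: "rec_eval (rfirst_const p) [c] (ltl_code (first_const p c))"
  unfolding rfirst_const_def
proof (induction c)
  case 0
  show ?case using rec_eval_rformula[of "LProp p"] by (auto intro: rec_eval.prim_0)
next
  case (Suc c)
  have "rec_eval (rpair (rconst 4) (RProj 1)) [c, ltl_code (first_const p c)]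
      (ltl_code (LNext (first_const p c)))"
    by (simp add: rec_eval_rpair rec_eval_rconst rec_eval_proj)
  from rec_eval.prim_Suc[OF Suc rec_eval_rconj[OF rec_eval_rformula this]]
  show ?case by simp
qed

text \<open>The goal has length \<open>4\<close> and name \<open>0\<close>; its other entries, on
  propositions \<open>3\<close> to \<open>5\<close>, are the arguments of this very program.\<close>

definition rgoal :: recf where
  "rgoal = rnot (rconj (rconj (rformula (first_const (1, 0) 4))
     (rconj (rformula (first_const (2, 0) 0))
       (rconj (RComp (rfirst_const (3, 0)) [RProj 0])
         (rconj (RComp (rfirst_const (4, 0)) [RProj 1])
           (rconj (RComp (rfirst_const (5, 0)) [RProj 2]) (rformula LTrue))))))
     (rformula (acceptf 0)))"

lemma rec_eval_rgoal: "rec_eval rgoal [m, k, b] (ltl_code (goalf [0, m, k, b]))"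
proof -
  have eq: "atomf 0 (map Cst [0, m, k, b]) =
      LAnd (first_const (1, 0) 4) (LAnd (first_const (2, 0) 0) (LAnd (first_const (3, 0) m)
        (LAnd (first_const (4, 0) k) (LAnd (first_const (5, 0) b) LTrue))))"
    by (simp add: atomf_def upt_rec numeral_eq_Suc)
  show ?thesis
    unfolding rgoal_def goalf_def eq
    by (intro rec_eval_rnot rec_eval_rconj rec_eval_rformula
        rec_eval_comp1[OF _ rec_eval_rfirst_const] rec_eval_proj) simp_all
qed

text \<open>Self-reference without a recursion theorem: the arguments code only the process,
  \<open>k\<close> and the rules, and the program adds the goal, which mentions these arguments. The
  rules do not contain the goal, so nothing is circular.\<close>

definition rinstance :: recf where
  "rinstance = rpair (RProj 0) (rcons (RProj 1) (rcons (rconj (RProj 2) rgoal)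
     (rconst (list_encode [pexp_code (Prob LTrue), cmp_code Greater_Eq, rat_code 0]))))"

lemma rec_eval_rinstance:
  "rec_eval rinstance [mdp_code M, k, ltl_code (rulesf k P)]
     (instance_code M (rules_phl k P [0, mdp_code M, k, ltl_code (rulesf k P)]))"
  unfolding rinstance_def instance_code_def rules_phl_def phl_code.simps
  by (intro rec_eval_rpair rec_eval_rcons rec_eval_rconj rec_eval_rgoal rec_eval_rconst
      rec_eval_proj) simp_all

theorem theorem6:
  shows "\<not> (\<exists>f. \<forall>M \<Phi>. mdp_input M \<and> closed_phl (mdp_props M) \<Phi> \<longrightarrow>
           rec_eval f [instance_code M \<Phi>] (if M \<Turnstile>\<^sub>P\<^sub>H\<^sub>L \<Phi> then 1 else 0))"
proof
  assume "\<exists>f. \<forall>M \<Phi>. mdp_input M \<and> closed_phl (mdp_props M) \<Phi> \<longrightarrow>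
    rec_eval f [instance_code M \<Phi>] (if M \<Turnstile>\<^sub>P\<^sub>H\<^sub>L \<Phi> then 1 else 0)"
  then obtain f where f: "\<And>M \<Phi>. mdp_input M \<Longrightarrow> closed_phl (mdp_props M) \<Phi> \<Longrightarrow>
      rec_eval f [instance_code M \<Phi>] (if M \<Turnstile>\<^sub>P\<^sub>H\<^sub>L \<Phi> then 1 else 0)"
    by blast
  \<comment> \<open>\<open>g\<close> applies the supposed decision procedure to the instance
    assembled from its own arguments.\<close>
  define g where "g = RComp f [rinstance]"
  define c :: clause where
    "c = ([Cst (val_name g) # Cst 1 # vars 3], Cst 0 # vars 3)"
  define P where "P = c # rules g 3"
  \<comment> \<open>\<open>k\<close> is chosen after the rules, which depend only on
    \<open>f\<close>, and exceeds the length \<open>4\<close> of the goal.\<close>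
  obtain k where k: "5 \<le> k" and fits: "\<forall>c\<in>set P. fits k c"
    using ex_fits_list by blast
  define M where "M = query_mdp k"
  define args where "args = [mdp_code M, k, ltl_code (rulesf k P)]"
  define \<Phi> where "\<Phi> = rules_phl k P (0 # args)"
  have k2: "2 \<le> k" and goal: "length (0 # args) < k" using k by (simp_all add: args_def)
  have "rec_eval f [instance_code M \<Phi>] (if M \<Turnstile>\<^sub>P\<^sub>H\<^sub>L \<Phi> then 1 else 0)"
    unfolding M_def \<Phi>_def by (intro f mdp_input_query_mdp closed_rules_phl[OF k2 fits goal])
  with rec_eval_rinstance[of M k P]
  have g: "rec_eval g args (if M \<Turnstile>\<^sub>P\<^sub>H\<^sub>L \<Phi> then 1 else 0)"
    unfolding g_def \<Phi>_def args_def by (rule rec_eval_comp1)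
  have len: "length args = 3" by (simp add: args_def)
  have sat: "M \<Turnstile>\<^sub>P\<^sub>H\<^sub>L \<Phi> \<longleftrightarrow> (\<exists>T. (\<forall>c\<in>set P. closed_under T c) \<and> 0 # args \<notin> T)"
    unfolding M_def \<Phi>_def by (rule phl_sat_rules_phl[OF k2 fits goal])
  show False
  proof (cases "M \<Turnstile>\<^sub>P\<^sub>H\<^sub>L \<Phi>")
    case True
    \<comment> \<open>The procedure answers \<open>1\<close>, so the goal is derivable and lies in
      every closed set, also in the one that should miss it.\<close>
    then obtain T where T: "\<forall>c\<in>set P. closed_under T c" "0 # args \<notin> T" using sat by blast
    have "rec_eval g args 1" using g True by simp
    then have "val_name g # 1 # args \<in> T"
      using T(1) len by (intro rec_eval_derivable) (simp_all add: P_def)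
    moreover have "closed_under T c" using T(1) by (simp add: P_def)
    moreover have "map (\<lambda>i. args ! i) [0..<3] = args" using map_nth[of args] len by simp
    ultimately have "0 # args \<in> T"
      using closed_underD[of T _ _ "\<lambda>i. args ! i"] by (fastforce simp: c_def comp_def)
    with T(2) show False ..
  next
    case False
    \<comment> \<open>The procedure answers \<open>0\<close>, so \<open>eval_facts g\<close> is a
      closed set without the goal, and the instance holds after all.\<close>
    then have "rec_eval g args 0" using g by simp
    then have "0 # args \<notin> eval_facts g" using rec_eval_deterministic by fastforce
    moreover have "closed_under (eval_facts g) c"
      by (auto simp: c_def closed_under_Pair comp_def)
    ultimately show False
      using False sat eval_facts_closed by (auto simp: P_def)
  qed
qed

end
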